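(* Let $0<q,r\le\infty$ and $\beta\in\mathbb{R}$. Then, for $f\in\mathrm T^{\infty,q,r}_\beta$, $$\|f\|_{\mathrm T^{\infty,q,r}_\beta}\simeq\sup_{P\in\square}\bigg(⨍_P\sum_{Q\subset P}\mathbf 1_Q(x)\,|Q|^{-\frac{\beta q}{d}}\,\|f\|^q_{L^r(\bar Q,\frac{\mathrm{d}y\,\mathrm{d}s}{s^{d+1}})}\,\mathrm{d}x\bigg)^{\frac1q},$$ with the usual modification if $q,r$ are infinite. The implicit constants depend only on $d,q,r,\beta$, and the sum runs over all dyadic cubes $Q\in\square$ with $Q\subset P$.
   Context: The symbol ⨍ denotes the mean-value integral and $B(x,t)$ the open ball in $\mathbb{R}^d$. $\mathrm T^{\infty,q,r}_\beta$ is the set of all measurable functions $f$ on $\mathbb{R}^{d+1}_+=(0,\infty)\times\mathbb{R}^d$ with finite (quasi-)norm $$\|f\|_{\mathrm T^{\infty,q,r}_\beta}=\sup_{\tau>0}\sup_{y\in\mathbb{R}^d}\bigg(\int_0^\tau⨍_{B(y,\tau)}\bigg(⨍_{t/2}^t⨍_{B(x,t)}|s^{-\beta}f(s,z)|^r\,\mathrm{d}z\,\mathrm{d}s\bigg)^{q/r}\frac{\mathrm{d}x\,\mathrm{d}t}{t}\bigg)^{1/q}\quad(q<\infty),$$ $$\|f\|_{\mathrm T^{\infty,\infty,r}_\beta}=\sup_{t>0}\sup_{x\in\mathbb{R}^d}\bigg(⨍_{t/2}^t⨍_{B(x,t)}|s^{-\beta}f(s,z)|^r\,\mathrm{d}z\,\mathrm{d}s\bigg)^{1/r},$$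 where for $r=\infty$ the inner averaged $L^r$-expression is replaced by the essential supremum over $(\frac t2,t]\times B(x,t)$. $\square_k=\{2^kx+[0,2^k)^d:x\in\mathbb{Z}^d\}$, $\square=\bigcup_{k\in\mathbb{Z}}\square_k$ is the family of all dyadic cubes; $\ell(Q)$ is the side length of $Q$; $\bar Q=(\frac{\ell(Q)}{2},\ell(Q)]\times Q$ is the Whitney box associated to $Q$ (not the closure). For $q=\infty$ the right-hand side is $\sup_{P\in\square}\sup_{Q\subset P}|Q|^{-\beta/d}\|f\|_{L^r(\bar Q,\mathrm{d}y\,\mathrm{d}s/s^{d+1})}$. *)

theory Defs
  imports "HOL-Probability.Essential_Supremum"
begin

section \<open>Powers, mean values and \<open>L\<^sup>r\<close> quasi-norms with values in \<open>[0,\<infinity>]\<close>\<close>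

text \<open>Only used with \<open>p > 0\<close>, so that \<open>0\<close> and \<open>\<infinity>\<close> are fixed.\<close>

definition ennpowr :: "ennreal \<Rightarrow> real \<Rightarrow> ennreal"  (infixr "pow\<^sub>e" 80) where
  "a pow\<^sub>e p = (if a = \<infinity> then \<infinity> else ennreal (enn2real a powr p))"

definition nn_mean :: "'a::euclidean_space set \<Rightarrow> ('a \<Rightarrow> ennreal) \<Rightarrow> ennreal" where
  "nn_mean A g = (\<integral>\<^sup>+x\<in>A. g x \<partial>lebesgue) / emeasure lebesgue A"

definition Lr_norm :: "ennreal \<Rightarrow> 'a measure \<Rightarrow> ('a \<Rightarrow> complex) \<Rightarrow> ennreal" where
  "Lr_norm r M g =
     (if r = \<infinity> then esssup M (\<lambda>x. ennreal (norm (g x)))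
      else (\<integral>\<^sup>+x. ennreal (norm (g x) powr enn2real r) \<partial>M) pow\<^sub>e (1 / enn2real r))"

section \<open>The endpoint tent spaces\<close>

text \<open>The averaged \<open>L\<^sup>r\<close> quasi-norm of \<open>s\<^sup>-\<^sup>\<beta> f(s,z)\<close> over \<open>(t/2,t] \<times> B(x,t)\<close>.\<close>

definition whitney_avg ::
  "ennreal \<Rightarrow> real \<Rightarrow> (real \<times> (real^'n::finite) \<Rightarrow> complex) \<Rightarrow> real \<Rightarrow> real^'n \<Rightarrow> ennreal" where
  "whitney_avg r \<beta> f t x =
     (if r = \<infinity>
      then esssup (lebesgue_on ({t/2<..t} \<times> ball x t))
             (\<lambda>(s,z). ennreal (norm (s powr (-\<beta>) *\<^sub>R f (s,z))))
      else nn_mean {t/2<..t} (\<lambda>s. nn_mean (ball x t) (\<lambda>z.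
             ennreal (norm (s powr (-\<beta>) *\<^sub>R f (s,z)) powr enn2real r))) pow\<^sub>e (1 / enn2real r))"

definition tent_norm ::
  "ennreal \<Rightarrow> ennreal \<Rightarrow> real \<Rightarrow> (real \<times> (real^'n::finite) \<Rightarrow> complex) \<Rightarrow> ennreal" where
  "tent_norm q r \<beta> f =
     (if q = \<infinity>
      then (SUP t\<in>{0<..}. SUP x. whitney_avg r \<beta> f t x)
      else (SUP \<tau>\<in>{0<..}. SUP y.
             (\<integral>\<^sup>+t\<in>{0<..<\<tau>}.
                nn_mean (ball y \<tau>) (\<lambda>x. whitney_avg r \<beta> f t x pow\<^sub>e enn2real q) * ennreal (1 / t)
              \<partial>lebesgue) pow\<^sub>e (1 / enn2real q)))"

text \<open>Functions on the upper half-space \<open>(0,\<infinity>) \<times> \<real>\<^sup>d\<close> are represented by total functions whose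
  values elsewhere are irrelevant.\<close>

definition tent_space ::
  "ennreal \<Rightarrow> ennreal \<Rightarrow> real \<Rightarrow> (real \<times> (real^'n::finite) \<Rightarrow> complex) set" where
  "tent_space q r \<beta> =
     {f. f \<in> borel_measurable (lebesgue_on ({0<..} \<times> UNIV)) \<and> tent_norm q r \<beta> f < \<infinity>}"

section \<open>Dyadic cubes\<close>

definition dyadic_cubes_at :: "int \<Rightarrow> (real^'n::finite) set set" where
  "dyadic_cubes_at k =
     {(\<lambda>u. 2 powi k *\<^sub>R (\<chi> i. of_int (m $ i)) + u) ` {u. \<forall>i. 0 \<le> u $ i \<and> u $ i < 2 powi k}
      | m :: int^'n. True}"

definition dyadic_cubes :: "(real^'n::finite) set set" where
  "dyadic_cubes = (\<Union>k. dyadic_cubes_at k)"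

definition side_length :: "(real^'n::finite) set \<Rightarrow> real" where
  "side_length Q = (THE l. \<exists>k. Q \<in> dyadic_cubes_at k \<and> l = 2 powi k)"

lemma dyadic_cubes_at_unique:
  fixes Q :: "(real^'n::finite) set"
  assumes "Q \<in> dyadic_cubes_at k" "Q \<in> dyadic_cubes_at k'"
  shows "k = k'"
proof -
  have le: "k' \<le> k" if Q: "Q \<in> dyadic_cubes_at k" and Q': "Q \<in> dyadic_cubes_at k'"
    for k k' and Q :: "(real^'n) set"
  proof (rule ccontr)
    assume "\<not> k' \<le> k"
    then have lt: "(2::real) powi k < 2 powi k'"
      by (intro power_int_strict_increasing) auto
    obtain a :: "real^'n" where a: "Q = (\<lambda>u. a + u) ` {u. \<forall>i. 0 \<le> u $ i \<and> u $ i < 2 powi k}"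
      using Q unfolding dyadic_cubes_at_def by blast
    obtain b :: "real^'n" where b: "Q = (\<lambda>u. b + u) ` {u. \<forall>i. 0 \<le> u $ i \<and> u $ i < 2 powi k'}"
      using Q' unfolding dyadic_cubes_at_def by blast
    have "b + 0 \<in> Q" "b + (\<chi> i. 2 powi k) \<in> Q"
      unfolding b using lt by (auto intro!: imageI)
    then obtain u v where u: "b + 0 = a + u" "\<forall>i. 0 \<le> u $ i"
        and v: "b + (\<chi> i. 2 powi k) = a + v" "\<forall>i. v $ i < 2 powi k"
      unfolding a by auto
    fix i :: 'n
    have "b $ i = a $ i + u $ i" "b $ i + 2 powi k = a $ i + v $ i"
      using arg_cong[OF u(1), of "\<lambda>w. w $ i"] arg_cong[OF v(1), of "\<lambda>w. w $ i"] by simp_all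
    moreover have "0 \<le> u $ i" "v $ i < 2 powi k" using u(2) v(2) by auto
    ultimately show False by linarith
  qed
  from le[OF assms] le[OF assms(2,1)] show ?thesis by simp
qed

lemma side_length_eq: "Q \<in> dyadic_cubes_at k \<Longrightarrow> side_length Q = 2 powi k"
  unfolding side_length_def by (rule the_equality) (auto dest: dyadic_cubes_at_unique)

definition whitney_box :: "(real^'n::finite) set \<Rightarrow> (real \<times> (real^'n)) set" where
  "whitney_box Q = {side_length Q / 2 <.. side_length Q} \<times> Q"

text \<open>The measure \<open>dy ds / s\<^sup>d\<^sup>+\<^sup>1\<close> on the Whitney box.\<close>

definition whitney_measure :: "(real^'n::finite) set \<Rightarrow> (real \<times> (real^'n)) measure" where
  "whitney_measure Q =
     density (lebesgue_on (whitney_box Q)) (\<lambda>(s,y). ennreal (1 / s ^ (CARD('n) + 1)))"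

definition dyadic_norm ::
  "ennreal \<Rightarrow> ennreal \<Rightarrow> real \<Rightarrow> (real \<times> (real^'n::finite) \<Rightarrow> complex) \<Rightarrow> ennreal" where
  "dyadic_norm q r \<beta> f =
     (if q = \<infinity>
      then (SUP P\<in>dyadic_cubes. SUP Q\<in>{Q \<in> dyadic_cubes. Q \<subseteq> P}.
              ennreal (measure lebesgue Q powr (-\<beta> / CARD('n))) * Lr_norm r (whitney_measure Q) f)
      else (SUP P\<in>dyadic_cubes.
              nn_mean P (\<lambda>x. \<Sum>\<^sub>\<infinity>Q\<in>{Q \<in> dyadic_cubes. Q \<subseteq> P}.
                indicator Q x * ennreal (measure lebesgue Q powr (-(\<beta> * enn2real q) / CARD('n)))
                  * Lr_norm r (whitney_measure Q) f pow\<^sub>e enn2real q)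
              pow\<^sub>e (1 / enn2real q)))"

end

theory Submission
  imports Defs
begin

text \<open>Let \<open>N(E)\<close> be the \<open>L\<^sup>r\<close> quasi-norm of \<open>s\<^sup>-\<^sup>\<beta> f(s,y)\<close> on \<open>E\<close> with respect to
  \<open>dy ds / s\<^sup>d\<^sup>+\<^sup>1\<close>. Up to constants, the Whitney average at \<open>(t,x)\<close> is \<open>N\<close> of its averaging region,
  and \<open>|Q|\<^sup>-\<^sup>\<beta>\<^sup>/\<^sup>d\<close> times the local norm of \<open>f\<close> on the Whitney box of \<open>Q\<close> is \<open>N\<close> of that box. The
  averaging region is covered by boundedly many Whitney boxes of comparable size, and a Whitney
  box by boundedly many pieces, each lying in the averaging regions of all points \<open>(t,x)\<close> with
  \<open>t\<close> in a suitable interval of length \<open>\<ell>(Q)/4\<close> and \<open>x\<close> in a subcube of \<open>Q\<close>; in a finite cover the set with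
  the largest \<open>N\<close> dominates. Integrating these pointwise comparisons over Carleson boxes
  gives both inequalities.\<close>

section \<open>Powers and quasi-norms\<close>

text \<open>The only t whose height interval (t/2, t] contains (\<ell>/2, \<ell>] is t = \<ell>, a
  null set of heights, so a whole Whitney box cannot be compared with averaging regions on a set of
  positive measure. Halving the box in height cures this: (\<ell>/2, 3\<ell>/4] fits for every t in
  (3\<ell>/4, \<ell>), and (3\<ell>/4, \<ell>] for every t in (\<ell>, 5\<ell>/4). Keeping the
  largest piece instead of adding up pieces treats all exponents 0 < r \<le> \<infinity> alike,
  although the triangle inequality fails for r < 1. The dominating cube or piece depends on f, but
  no measurable selection is made. Towards the tent norm, the dominating cube is one term of a sum
  over all cubes in range; towards the dyadic norm, one piece is chosen for each of countably many
  cubes. What has to be computed is then the integral of a countable sum of multiples of indicators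
  of rectangles, and the rectangle attached to Q has mass comparable to |Q| for dx dt/t.\<close>

lemma ennpowr_top [simp]: "top pow\<^sub>e p = top"
  by (simp add: ennpowr_def)

lemma ennpowr_ennreal [simp]: "0 \<le> a \<Longrightarrow> ennreal a pow\<^sub>e p = ennreal (a powr p)"
  by (simp add: ennpowr_def)

lemma ennpowr_zero [simp]: "0 pow\<^sub>e p = 0"
  by (simp add: ennpowr_def)

lemma ennpowr_mono:
  assumes "a \<le> b" "0 < p"
  shows "a pow\<^sub>e p \<le> b pow\<^sub>e p"
proof (cases b)
  case (real v)
  then obtain u where "a = ennreal u" "0 \<le> u" "u \<le> v"
    using assms by (cases a) (auto simp: top_unique)
  then show ?thesis using real assms by (simp add: ennreal_leI powr_mono2)
qed simp

lemma ennpowr_mult: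
  assumes "0 < p"
  shows "(a * b) pow\<^sub>e p = a pow\<^sub>e p * b pow\<^sub>e p"
  using assms
  by (cases a; cases b; cases "a = 0"; cases "b = 0")
     (auto simp: powr_mult ennreal_mult_eq_top_iff ennreal_mult[symmetric] ennreal_top_mult ennreal_mult_top)

lemma ennpowr_ennpowr_inverse:
  assumes "0 < p"
  shows "(a pow\<^sub>e p) pow\<^sub>e (1 / p) = a" "(a pow\<^sub>e (1 / p)) pow\<^sub>e p = a"
  using assms by (cases a; simp add: powr_powr)+

text \<open>Turns the sum in the dyadic norm into an integral, so that exchanging it with Lebesgue
  integrals is an instance of Tonelli's theorem.\<close>

lemma infsum_eq_nn_integral_count_space:
  fixes f :: "'a \<Rightarrow> ennreal"
  assumes "countable A"
  shows "infsum f A = (\<integral>\<^sup>+x. f x \<partial>count_space A)"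
proof (cases "finite A")
  case True
  then show ?thesis by (simp add: nn_integral_count_space_finite)
next
  case False
  define g where "g = from_nat_into A"
  have g: "bij_betw g UNIV A"
    using bij_betw_from_nat_into[OF assms False] by (simp add: g_def)
  have "infsum f A = infsum (\<lambda>n. f (g n)) UNIV"
    by (rule infsum_reindex_bij_betw[OF g, symmetric])
  also have "\<dots> = (\<Sum>n. f (g n))"
    by (intro sums_unique has_sum_imp_sums has_sum_infsum nonneg_summable_on_complete) simp
  also have "\<dots> = (\<integral>\<^sup>+n. f (g n) \<partial>count_space UNIV)"
    by (simp add: nn_integral_count_space_nat)
  also have "\<dots> = (\<integral>\<^sup>+x. f x \<partial>count_space A)"
    by (rule nn_integral_bij_count_space[OF g])
  finally show ?thesis .
qed

text \<open>Monotonicity and homogeneity in one statement, for finite and infinite exponents at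
  once. It serves to trade the factor s^(-\<beta>) for a constant on a Whitney box.\<close>

lemma Lr_norm_scale:
  assumes r: "0 < r" and c: "0 < c"
    and g: "g \<in> borel_measurable M" and h: "h \<in> borel_measurable M"
    and le: "\<And>x. x \<in> space M \<Longrightarrow> norm (g x) \<le> c * norm (h x)"
  shows "Lr_norm r M g \<le> ennreal c * Lr_norm r M h"
proof (cases "r = \<infinity>")
  case True
  have "AE x in M. ennreal (norm (g x)) \<le> ennreal c * esssup M (\<lambda>x. ennreal (norm (h x)))"
    using esssup_AE[of "\<lambda>x. ennreal (norm (h x))" M] AE_space
  proof eventually_elim
    case (elim x)
    have "ennreal (norm (g x)) \<le> ennreal c * ennreal (norm (h x))"
      using le[OF elim(2)] c by (simp add: ennreal_leI flip: ennreal_mult)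
    also have "\<dots> \<le> ennreal c * esssup M (\<lambda>x. ennreal (norm (h x)))"
      using elim(1) by (rule mult_left_mono) simp
    finally show ?case .
  qed
  then show ?thesis using g True by (auto simp: Lr_norm_def)
next
  case False
  define p where "p = enn2real r"
  have p: "0 < p" using r False by (cases r) (auto simp: p_def)
  have "(\<integral>\<^sup>+x. ennreal (norm (g x) powr p) \<partial>M)
      \<le> (\<integral>\<^sup>+x. ennreal (c powr p) * ennreal (norm (h x) powr p) \<partial>M)"
  proof (rule nn_integral_mono)
    fix x assume "x \<in> space M"
    from le[OF this] have "norm (g x) powr p \<le> (c * norm (h x)) powr p"
      using p by (intro powr_mono2) auto
    then show "ennreal (norm (g x) powr p) \<le> ennreal (c powr p) * ennreal (norm (h x) powr p)"
      using c by (simp add: powr_mult ennreal_leI flip: ennreal_mult)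
  qed
  also have "\<dots> = ennreal c pow\<^sub>e p * (\<integral>\<^sup>+x. ennreal (norm (h x) powr p) \<partial>M)"
    using h c by (subst nn_integral_cmult) auto
  finally have "(\<integral>\<^sup>+x. ennreal (norm (g x) powr p) \<partial>M) pow\<^sub>e (1 / p)
      \<le> (ennreal c pow\<^sub>e p * (\<integral>\<^sup>+x. ennreal (norm (h x) powr p) \<partial>M)) pow\<^sub>e (1 / p)"
    using p by (intro ennpowr_mono) auto
  also have "\<dots> = ennreal c * (\<integral>\<^sup>+x. ennreal (norm (h x) powr p) \<partial>M) pow\<^sub>e (1 / p)"
    using p by (subst ennpowr_mult) (simp_all add: ennpowr_ennpowr_inverse del: ennpowr_ennreal)
  finally show ?thesis using False by (simp add: Lr_norm_def p_def)
qed

section \<open>Dyadic cubes\<close>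

text \<open>Cubes as fibres of the coordinatewise map floor(x_i / 2^k): that they partition space
  and are nested becomes integer arithmetic on the index \<open>m\<close>.\<close>

definition dyadic_cube :: "int \<Rightarrow> int^'n \<Rightarrow> (real^'n::finite) set" where
  "dyadic_cube k m = {x. \<forall>i. \<lfloor>x $ i / 2 powi k\<rfloor> = m $ i}"

lemma dyadic_cubes_at_eq: "dyadic_cubes_at k = range (dyadic_cube k :: int^'n \<Rightarrow> (real^'n::finite) set)"
proof -
  have "(\<lambda>u. 2 powi k *\<^sub>R (\<chi> i. of_int (m $ i)) + u) ` {u. \<forall>i. 0 \<le> u $ i \<and> u $ i < 2 powi k}
      = dyadic_cube k m" (is "?L = _") for m :: "int^'n"
  proof (intro set_eqI iffI)
    fix x :: "real^'n" assume "x \<in> ?L"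
    then show "x \<in> dyadic_cube k m"
      by (auto simp: dyadic_cube_def floor_eq_iff field_simps)
  next
    fix x :: "real^'n" assume "x \<in> dyadic_cube k m"
    then have "of_int (m $ i) * 2 powi k \<le> x $ i \<and> x $ i < (of_int (m $ i) + 1) * 2 powi k" for i
      by (auto simp: dyadic_cube_def floor_eq_iff field_simps)
    then show "x \<in> ?L"
      by (intro image_eqI[of _ _ "x - 2 powi k *\<^sub>R (\<chi> i. of_int (m $ i))"])
         (auto simp: algebra_simps)
  qed
  then show ?thesis by (auto simp: dyadic_cubes_at_def)
qed

lemma mem_dyadic_cube_iff:
  "x \<in> dyadic_cube k m \<longleftrightarrow> (\<forall>i. of_int (m $ i) * 2 powi k \<le> x $ i \<and> x $ i < (of_int (m $ i) + 1) * 2 powi k)"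
  by (auto simp: dyadic_cube_def floor_eq_iff field_simps)

lemma ex1_dyadic_cubes_at: "\<exists>!Q. Q \<in> dyadic_cubes_at k \<and> (x :: real^'n::finite) \<in> Q"
proof
  show "dyadic_cube k (\<chi> i. \<lfloor>x $ i / 2 powi k\<rfloor>) \<in> dyadic_cubes_at k \<and>
        x \<in> dyadic_cube k (\<chi> i. \<lfloor>x $ i / 2 powi k\<rfloor>)"
    unfolding dyadic_cubes_at_eq by (intro conjI rangeI) (simp add: dyadic_cube_def)
next
  fix Q assume "Q \<in> dyadic_cubes_at k \<and> x \<in> Q"
  then obtain m where Q: "Q = dyadic_cube k m" "x \<in> dyadic_cube k m"
    by (auto simp: dyadic_cubes_at_eq)
  then have "m = (\<chi> i. \<lfloor>x $ i / 2 powi k\<rfloor>)"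
    by (auto simp: dyadic_cube_def vec_eq_iff)
  then show "Q = dyadic_cube k (\<chi> i. \<lfloor>x $ i / 2 powi k\<rfloor>)"
    using Q by simp
qed

lemma dyadic_cubes_at_nonempty: "Q \<in> dyadic_cubes_at k \<Longrightarrow> \<exists>x. x \<in> (Q :: (real^'n::finite) set)"
  by (fastforce simp: dyadic_cubes_at_def intro!: image_eqI[of _ _ 0])

text \<open>The index at the coarser scale is a function of the index at the finer one, namely its
  integer quotient by 2^(k-j). One common point therefore decides for the whole small cube.\<close>

lemma dyadic_cubes_nested:
  fixes Q :: "(real^'n::finite) set"
  assumes Q: "Q \<in> dyadic_cubes_at j" and "j \<le> k"
    and P: "P \<in> dyadic_cubes_at k" and "Q \<inter> P \<noteq> {}"
  shows "Q \<subseteq> P"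
proof
  define b :: int where "b = 2 ^ nat (k - j)"
  have b: "0 \<le> b" "(2::real) powi k = 2 powi j * of_int b"
    using \<open>j \<le> k\<close> power_int_add[of "2::real" j "k - j"]
    by (auto simp: b_def power_int_def)
  have "\<lfloor>u / 2 powi k\<rfloor> = \<lfloor>u / 2 powi j\<rfloor> div b" for u :: real
    using floor_divide_real_eq_div[OF b(1), of "u / 2 powi j"] by (simp add: b(2))
  moreover obtain m n where "Q = dyadic_cube j m" "P = dyadic_cube k n"
    using Q P by (auto simp: dyadic_cubes_at_eq)
  moreover fix x assume "x \<in> Q"
  ultimately show "x \<in> P"
    using \<open>Q \<inter> P \<noteq> {}\<close> by (auto simp: dyadic_cube_def)
qed

lemma countable_dyadic_cubes: "countable (dyadic_cubes :: (real^'n::finite) set set)"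
  by (auto simp: dyadic_cubes_def dyadic_cubes_at_eq)

text \<open>In each coordinate the index of such a cube differs by at most \<open>c\<close> from the
  index of the cube around \<open>x\<close>, which leaves 2c+1 values.\<close>

lemma card_dyadic_cubes_meeting_ball:
  fixes x :: "real^'n::finite"
  assumes "\<rho> \<le> real c * 2 powi k"
  defines "F \<equiv> {Q \<in> dyadic_cubes_at k. Q \<inter> ball x \<rho> \<noteq> {}}"
  shows "finite F" "card F \<le> (2 * c + 1) ^ CARD('n)"
proof -
  define I where "I = (\<Pi>\<^sub>E i\<in>(UNIV::'n set). {- int c..int c})"
  define h where "h e = (dyadic_cube k (\<chi> i. \<lfloor>x $ i / 2 powi k\<rfloor> + e i) :: (real^'n) set)" for e
  have I: "finite I" "card I = (2 * c + 1) ^ CARD('n)"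
    by (auto simp: I_def card_PiE nat_add_distrib nat_mult_distrib intro!: finite_PiE)
  have "F \<subseteq> h ` I"
  proof
    fix Q assume "Q \<in> F"
    then obtain z where z: "z \<in> Q" "dist x z < \<rho>" by (auto simp: F_def)
    from \<open>Q \<in> F\<close> obtain m where Q: "Q = dyadic_cube k m"
      by (auto simp: F_def dyadic_cubes_at_eq)
    define e where "e i = m $ i - \<lfloor>x $ i / 2 powi k\<rfloor>" for i
    have "e i \<in> {- int c..int c}" for i
    proof -
      have "\<bar>x $ i - z $ i\<bar> < real c * 2 powi k"
        using dist_vec_nth_le[of x i z] z(2) assms(1) by (simp add: dist_real_def)
      then have "\<bar>x $ i / 2 powi k - z $ i / 2 powi k\<bar> < real c"
        by (simp add: field_simps abs_less_iff)
      moreover have "m $ i = \<lfloor>z $ i / 2 powi k\<rfloor>"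
        using z(1) by (simp add: Q dyadic_cube_def)
      ultimately show ?thesis unfolding e_def by (simp add: abs_less_iff) linarith
    qed
    then have "e \<in> I" by (simp add: I_def PiE_iff extensional_def)
    moreover have "Q = h e" by (simp add: Q h_def e_def)
    ultimately show "Q \<in> h ` I" by blast
  qed
  with I show "finite F" "card F \<le> (2 * c + 1) ^ CARD('n)"
    by (auto intro: finite_subset dest: surj_card_le[rotated])
qed

text \<open>Bounding by the sum of the coordinates gives the factor d instead of its square root,
  which keeps all later geometric constants integral.\<close>

lemma dist_dyadic_cube_le:
  fixes Q :: "(real^'n::finite) set"
  assumes "Q \<in> dyadic_cubes_at k" "x \<in> Q" "y \<in> Q"
  shows "dist x y \<le> CARD('n) * 2 powi k"
proof -
  obtain m where "Q = dyadic_cube k m" using assms(1) by (auto simp: dyadic_cubes_at_eq)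
  then have "\<bar>(x - y) $ i\<bar> \<le> 2 powi k" for i
    using assms(2,3) by (auto simp: mem_dyadic_cube_iff abs_le_iff algebra_simps) (smt (verit))+
  then have "(\<Sum>i\<in>UNIV. \<bar>(x - y) $ i\<bar>) \<le> (\<Sum>i\<in>(UNIV::'n set). 2 powi k)"
    by (intro sum_mono)
  then show ?thesis using norm_le_l1_cart[of "x - y"] by (simp add: dist_norm)
qed

text \<open>The half-open cube is squeezed between the open and the closed box with the same
  corners, which have equal volume.\<close>

lemma dyadic_cube_measure:
  fixes Q :: "(real^'n::finite) set"
  assumes "Q \<in> dyadic_cubes_at k"
  shows "Q \<in> sets borel" "emeasure lebesgue Q = ennreal ((2 powi k) ^ CARD('n))"
proof -
  obtain m where Q: "Q = dyadic_cube k m" using assms(1) by (auto simp: dyadic_cubes_at_eq)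
  have "Q = (\<Inter>i. {x. of_int (m $ i) * 2 powi k \<le> x $ i} \<inter> {x. x $ i < (of_int (m $ i) + 1) * 2 powi k})"
    by (auto simp: Q mem_dyadic_cube_iff)
  also have "\<dots> \<in> sets borel"
    by (intro sets.countable_INT'' sets.Int borel_closed borel_open) 
       (auto intro!: closed_halfspace_component_ge_cart open_halfspace_component_lt_cart)
  finally show meas: "Q \<in> sets borel" .
  define a :: "real^'n" where "a = (\<chi> i. of_int (m $ i) * 2 powi k)"
  define b :: "real^'n" where "b = (\<chi> i. (of_int (m $ i) + 1) * 2 powi k)"
  have *: "emeasure lborel (cbox a b) = ennreal ((2 powi k) ^ CARD('n))"
       "emeasure lborel (box a b) = ennreal ((2 powi k) ^ CARD('n))"
  proof -
    have le: "a \<bullet> i \<le> b \<bullet> i" and d: "(b - a) \<bullet> i = 2 powi k" if "i \<in> Basis" for i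
      using that by (auto simp: a_def b_def Basis_vec_def inner_axis algebra_simps)
    show "emeasure lborel (cbox a b) = ennreal ((2 powi k) ^ CARD('n))"
      using le d by simp
    show "emeasure lborel (box a b) = ennreal ((2 powi k) ^ CARD('n))"
      using le d by simp
  qed
  have "box a b \<subseteq> Q" "Q \<subseteq> cbox a b"
    by (auto simp: Q mem_dyadic_cube_iff a_def b_def mem_box_cart less_imp_le)
  then have "emeasure lborel (box a b) \<le> emeasure lborel Q" "emeasure lborel Q \<le> emeasure lborel (cbox a b)"
    using meas by (auto intro!: emeasure_mono)
  then show "emeasure lebesgue Q = ennreal ((2 powi k) ^ CARD('n))"
    using meas by (simp add: * antisym)
qed

section \<open>Local norms on the half-space\<close>

text \<open>A section of a Lebesgue measurable function is controlled only for almost every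
  \<open>s\<close>. So \<open>h\<close> is replaced by a Borel function equal to it almost
  everywhere, Tonelli is applied there, and the change on null sets is transported to almost all
  sections.\<close>

lemma nn_mean_nn_mean:
  fixes h :: "real \<times> 'a::euclidean_space \<Rightarrow> ennreal"
  assumes T: "T \<in> sets borel" and B: "B \<in> sets borel"
    and h: "h \<in> borel_measurable (lebesgue_on (T \<times> B))"
  shows "nn_mean T (\<lambda>s. nn_mean B (\<lambda>z. h (s, z)))
    = (\<integral>\<^sup>+x\<in>T \<times> B. h x \<partial>lebesgue) / emeasure lebesgue B / emeasure lebesgue T"
proof -
  define h1 where "h1 x = h x * indicator (T \<times> B) x" for x
  have TB: "T \<times> B \<in> sets borel"
    using T B by (simp add: borel_Times)
  then have "h1 \<in> borel_measurable lebesgue"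
    using h unfolding h1_def by (subst (asm) borel_measurable_restrict_space_iff_ennreal) auto
  then obtain h' where [measurable]: "h' \<in> borel_measurable lborel" and h': "AE x in lborel. h1 x = h' x"
    using completion_ex_borel_measurable by blast
  have [measurable]: "h' \<in> borel_measurable (lborel \<Otimes>\<^sub>M lborel)"
    by (simp add: lborel_prod)
  have "AE x in lborel \<Otimes>\<^sub>M lborel. h1 x = h' x"
    unfolding lborel_prod by (fact h')
  then have AE: "AE s in lborel. AE z in lborel. h1 (s, z) = h' (s, z)"
    by (rule lborel_pair.AE_pair)
  have "nn_mean T (\<lambda>s. nn_mean B (\<lambda>z. h (s, z)))
      = (\<integral>\<^sup>+s. ((\<integral>\<^sup>+z. h (s, z) * indicator B z \<partial>lborel) / emeasure lborel B) * indicator T s \<partial>lborel)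
          / emeasure lborel T"
    using T B by (simp add: nn_mean_def nn_integral_completion)
  also have "(\<integral>\<^sup>+s. ((\<integral>\<^sup>+z. h (s, z) * indicator B z \<partial>lborel) / emeasure lborel B) * indicator T s \<partial>lborel)
      = (\<integral>\<^sup>+s. (\<integral>\<^sup>+z. h1 (s, z) \<partial>lborel) / emeasure lborel B \<partial>lborel)"
    by (intro nn_integral_cong) (auto simp: h1_def indicator_def)
  also have "\<dots> = (\<integral>\<^sup>+s. (\<integral>\<^sup>+z. h' (s, z) \<partial>lborel) / emeasure lborel B \<partial>lborel)"
    using AE by (intro nn_integral_cong_AE) (auto elim!: eventually_mono intro!: nn_integral_cong_AE arg_cong2[of _ _ _ _ "(/)"])
  also have "\<dots> = (\<integral>\<^sup>+s. (\<integral>\<^sup>+z. h' (s, z) \<partial>lborel) \<partial>lborel) / emeasure lborel B"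
    by (rule nn_integral_divide) measurable
  also have "(\<integral>\<^sup>+s. (\<integral>\<^sup>+z. h' (s, z) \<partial>lborel) \<partial>lborel) = (\<integral>\<^sup>+x. h' x \<partial>lborel)"
    by (subst lborel.nn_integral_fst) (simp_all add: lborel_prod)
  also have "\<dots> = (\<integral>\<^sup>+x. h1 x \<partial>lebesgue)"
    using h' by (auto simp: nn_integral_completion intro!: nn_integral_cong_AE)
  finally show ?thesis using T B by (simp add: h1_def)
qed

section \<open>The quasi-norm N(E) and its behaviour under inclusions and finite unions\<close>

abbreviation half_space :: "(real \<times> (real^'n::finite)) set" where
  "half_space \<equiv> {0<..} \<times> UNIV"

definition scaled_fun :: "real \<Rightarrow> (real \<times> (real^'n::finite) \<Rightarrow> complex) \<Rightarrow> real \<times> (real^'n) \<Rightarrow> complex" where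
  "scaled_fun \<beta> f = (\<lambda>(s, y). s powr (-\<beta>) *\<^sub>R f (s, y))"

definition tent_weight :: "real \<times> (real^'n::finite) \<Rightarrow> ennreal" where
  "tent_weight = (\<lambda>(s, y). ennreal (1 / s ^ (CARD('n) + 1)))"

text \<open>This is N(E) of the overview. With s^(-\<beta>) inside the norm and a fixed weight, the
  set E is the only thing that varies, so averaging regions and Whitney boxes can be compared by
  inclusion.\<close>

definition local_norm ::
  "ennreal \<Rightarrow> real \<Rightarrow> (real \<times> (real^'n::finite) \<Rightarrow> complex) \<Rightarrow> (real \<times> (real^'n)) set \<Rightarrow> ennreal" where
  "local_norm r \<beta> f E =
     Lr_norm r (density (lebesgue_on E) tent_weight) (scaled_fun \<beta> f)"

lemma measurable_lebesgue_on_subset: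
  assumes "f \<in> borel_measurable (lebesgue_on F)" "E \<subseteq> F"
  shows "f \<in> borel_measurable (lebesgue_on E)"
  using assms by (rule measurable_restrict_mono)

lemma borel_measurable_lebesgue_on_fst:
  fixes h :: "real \<Rightarrow> 'b::topological_space"
  assumes "h \<in> borel_measurable borel"
  shows "(\<lambda>x. h (fst x)) \<in> borel_measurable (lebesgue_on (E :: (real \<times> 'a::euclidean_space) set))"
proof -
  have "fst \<in> borel_measurable (borel :: (real \<times> 'a) measure)"
    by (intro borel_measurable_continuous_onI continuous_intros)
  then have "(\<lambda>x. h (fst x)) \<in> borel_measurable (borel :: (real \<times> 'a) measure)"
    using assms by measurable
  then show ?thesis by (intro measurable_restrict_space1 measurable_completion) simp
qed

lemma borel_measurable_tent_weight:
  "tent_weight \<in> borel_measurable (lebesgue_on E)"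
  unfolding tent_weight_def case_prod_beta by (rule borel_measurable_lebesgue_on_fst) measurable

lemma borel_measurable_scaled_fun:
  assumes "f \<in> borel_measurable (lebesgue_on E)"
  shows "scaled_fun \<beta> f \<in> borel_measurable (lebesgue_on E)"
proof -
  have [measurable]: "(\<lambda>x. fst x powr (-\<beta>)) \<in> borel_measurable (lebesgue_on E)"
    by (rule borel_measurable_lebesgue_on_fst) measurable
  show ?thesis unfolding scaled_fun_def case_prod_beta using assms by simp
qed

text \<open>The weight is positive on the half-space, so the weighted measure has the same null sets
  as Lebesgue measure and the essential supremum does not see it.\<close>

lemma local_norm_top:
  fixes f :: "real \<times> (real^'n::finite) \<Rightarrow> complex"
  assumes f: "f \<in> borel_measurable (lebesgue_on half_space)"
    and E: "E \<in> sets lebesgue" "E \<subseteq> half_space"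
  shows "local_norm top \<beta> f E = esssup (lebesgue_on E) (\<lambda>x. ennreal (norm (scaled_fun \<beta> f x)))"
proof -
  have [measurable]: "scaled_fun \<beta> f \<in> borel_measurable (lebesgue_on E)"
    using f E(2) by (intro borel_measurable_scaled_fun) (rule measurable_lebesgue_on_subset)
  have "(AE x in density (lebesgue_on E) tent_weight. P x)
      \<longleftrightarrow> (AE x in lebesgue_on E. P x)" for P
  proof (subst AE_density[OF borel_measurable_tent_weight], rule AE_cong)
    fix x assume "x \<in> space (lebesgue_on E)"
    then have "0 < fst x" using E by auto
    then show "(0 < tent_weight x \<longrightarrow> P x) \<longleftrightarrow> P x"
      by (auto simp: tent_weight_def case_prod_beta)
  qed
  then show ?thesis by (simp add: local_norm_def Lr_norm_def esssup_eq_AE)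
qed

lemma local_norm_top_AE:
  fixes f :: "real \<times> (real^'n::finite) \<Rightarrow> complex"
  assumes "f \<in> borel_measurable (lebesgue_on half_space)"
    and "E \<in> sets lebesgue" "E \<subseteq> half_space"
  shows "AE x in lebesgue. x \<in> E \<longrightarrow> ennreal (norm (scaled_fun \<beta> f x)) \<le> local_norm top \<beta> f E"
  using esssup_AE[of "\<lambda>x. ennreal (norm (scaled_fun \<beta> f x))" "lebesgue_on E"] assms
  by (simp add: local_norm_top AE_restrict_space_iff)

lemma local_norm_top_leI:
  fixes f :: "real \<times> (real^'n::finite) \<Rightarrow> complex"
  assumes f: "f \<in> borel_measurable (lebesgue_on half_space)"
    and E: "E \<in> sets lebesgue" "E \<subseteq> half_space"
    and "AE x in lebesgue. x \<in> E \<longrightarrow> ennreal (norm (scaled_fun \<beta> f x)) \<le> c"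
  shows "local_norm top \<beta> f E \<le> c"
proof -
  have [measurable]: "scaled_fun \<beta> f \<in> borel_measurable (lebesgue_on E)"
    using f E(2) by (intro borel_measurable_scaled_fun) (rule measurable_lebesgue_on_subset)
  show ?thesis using assms by (simp add: local_norm_top AE_restrict_space_iff esssup_I)
qed

text \<open>For finite exponents the \<open>r\<close>-th power of the local quasi-norm is a measure, which yields
  monotonicity and finite subadditivity.\<close>

lemma local_norm_finite:
  fixes f :: "real \<times> (real^'n::finite) \<Rightarrow> complex" and r :: ennreal and \<beta> :: real
  assumes f: "f \<in> borel_measurable (lebesgue_on half_space)"
    and E: "E \<in> sets lebesgue" "E \<subseteq> half_space" and r: "r \<noteq> top"
  defines "\<nu> \<equiv> density (lebesgue_on half_space)
      (\<lambda>x. tent_weight x *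
           ennreal (norm (scaled_fun \<beta> f x) powr enn2real r))"
  shows "local_norm r \<beta> f E = emeasure \<nu> E pow\<^sub>e (1 / enn2real r)" and "E \<in> sets \<nu>"
    and "emeasure \<nu> E = (\<integral>\<^sup>+x\<in>E. tent_weight x *
           ennreal (norm (scaled_fun \<beta> f x) powr enn2real r) \<partial>lebesgue)"
proof -
  have H: "half_space \<in> sets (lebesgue :: (real \<times> (real^'n)) measure)"
    by (intro sets_completionI_sets) (auto simp: borel_Times)
  have [measurable]: "scaled_fun \<beta> f \<in> borel_measurable (lebesgue_on E)"
    "scaled_fun \<beta> f \<in> borel_measurable (lebesgue_on half_space)"
    using f E(2) by (auto intro!: borel_measurable_scaled_fun intro: measurable_lebesgue_on_subset)
  note [measurable] = borel_measurable_tent_weight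
  show *: "E \<in> sets \<nu>"
    using E H by (auto simp: \<nu>_def sets_restrict_space_iff)
  then have E': "E \<in> sets (lebesgue_on half_space)" by (simp add: \<nu>_def)
  have "emeasure \<nu> E = (\<integral>\<^sup>+x. (tent_weight x *
           ennreal (norm (scaled_fun \<beta> f x) powr enn2real r)) * indicator E x \<partial>lebesgue_on half_space)"
    unfolding \<nu>_def using E' by (subst emeasure_density) auto
  also have "\<dots> = (\<integral>\<^sup>+x\<in>E. tent_weight x *
           ennreal (norm (scaled_fun \<beta> f x) powr enn2real r) \<partial>lebesgue)"
    using H E(2) by (subst nn_integral_restrict_space) (auto intro!: nn_integral_cong simp: indicator_def)
  finally show **: "emeasure \<nu> E = \<dots>" .
  show "local_norm r \<beta> f E = emeasure \<nu> E pow\<^sub>e (1 / enn2real r)"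
    using r E(1) unfolding ** local_norm_def Lr_norm_def
    by (simp add: nn_integral_density nn_integral_restrict_space)
qed

lemma local_norm_mono:
  fixes f :: "real \<times> (real^'n::finite) \<Rightarrow> complex"
  assumes f: "f \<in> borel_measurable (lebesgue_on half_space)" and r: "0 < r"
    and E: "E \<in> sets lebesgue" and F: "F \<in> sets lebesgue" "F \<subseteq> half_space" and "E \<subseteq> F"
  shows "local_norm r \<beta> f E \<le> local_norm r \<beta> f F"
proof (cases "r = top")
  case True
  have "AE x in lebesgue. x \<in> E \<longrightarrow> ennreal (norm (scaled_fun \<beta> f x)) \<le> local_norm top \<beta> f F"
    using local_norm_top_AE[OF f F, of \<beta>] \<open>E \<subseteq> F\<close> by (auto elim!: eventually_mono)
  then show ?thesis using local_norm_top_leI[OF f E] True assms by auto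
next
  case False
  have E': "E \<subseteq> half_space" using assms by auto
  show ?thesis
    unfolding local_norm_finite(1)[OF f E E' False] local_norm_finite(1)[OF f F False]
    using r False assms local_norm_finite(2)[OF f F False]
    by (intro ennpowr_mono emeasure_mono) (auto simp: enn2real_positive_iff less_top)
qed

text \<open>For finite \<open>r\<close>, the \<open>r\<close>-th powers are subadditive and each is
  at most the largest one; the \<open>r\<close>-th root of the number of sets is the price. Naming
  one index, rather than bounding by a sum, means that only a single cube has to be followed
  afterwards.\<close>

lemma local_norm_UN:
  fixes f :: "real \<times> (real^'n::finite) \<Rightarrow> complex"
  assumes f: "f \<in> borel_measurable (lebesgue_on half_space)" and r: "0 < r"
    and I: "finite I" "I \<noteq> {}" "card I \<le> n"
    and E: "\<And>i. i \<in> I \<Longrightarrow> E i \<in> sets lebesgue" "\<And>i. i \<in> I \<Longrightarrow> E i \<subseteq> half_space"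
  shows "\<exists>i\<in>I. local_norm r \<beta> f (\<Union>i\<in>I. E i) \<le> ennreal (real n powr (1 / enn2real r)) * local_norm r \<beta> f (E i)"
proof -
  let ?N = "\<lambda>i. local_norm r \<beta> f (E i)"
  have "Max (?N ` I) \<in> ?N ` I" using I by (intro Max_in) auto
  then obtain i where i: "i \<in> I" "?N i = Max (?N ` I)" by force
  have max: "?N j \<le> ?N i" if "j \<in> I" for j
    using i(2) that I by simp
  have U: "(\<Union>i\<in>I. E i) \<in> sets lebesgue" "(\<Union>i\<in>I. E i) \<subseteq> half_space"
    using I E by auto
  \<comment> \<open>In the case \<open>r = top\<close> the exponent \<open>1 / enn2real r\<close> is
    1/0 = 0, and the factor is then 1 because \<open>n\<close> is nonzero (\<open>0 powr 0\<close>
    would be 0).\<close>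
  have n: "1 \<le> real n" using I card_gt_0_iff[of I] by linarith
  have "local_norm r \<beta> f (\<Union>i\<in>I. E i) \<le> ennreal (real n powr (1 / enn2real r)) * ?N i"
  proof (cases "r = top")
    case True
    have "AE x in lebesgue. \<forall>j\<in>I. x \<in> E j \<longrightarrow> ennreal (norm (scaled_fun \<beta> f x)) \<le> local_norm top \<beta> f (E j)"
      using I E by (intro AE_finite_allI local_norm_top_AE f) auto
    then have "AE x in lebesgue. x \<in> (\<Union>i\<in>I. E i) \<longrightarrow> ennreal (norm (scaled_fun \<beta> f x)) \<le> ?N i"
      using max True by (auto elim!: eventually_mono intro: order_trans)
    with True n show ?thesis using local_norm_top_leI[OF f U] by simp
  next
    case False
    define p where "p = enn2real r"
    have p: "0 < p" using r False by (simp add: p_def enn2real_positive_iff less_top)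
    define \<nu> where "\<nu> = density (lebesgue_on half_space)
      (\<lambda>x. tent_weight x *
           ennreal (norm (scaled_fun \<beta> f x) powr enn2real r))"
    note fin = local_norm_finite[OF f _ _ False, of _ \<beta>, folded \<nu>_def, folded p_def]
    have "emeasure \<nu> (\<Union>i\<in>I. E i) \<le> (\<Sum>j\<in>I. emeasure \<nu> (E j))"
      using I fin(2) E by (intro emeasure_subadditive_finite) auto
    also have "\<dots> \<le> (\<Sum>j\<in>I. emeasure \<nu> (E i))"
    proof (rule sum_mono)
      fix j assume "j \<in> I"
      have "?N j pow\<^sub>e p \<le> ?N i pow\<^sub>e p" using max[OF \<open>j \<in> I\<close>] p by (rule ennpowr_mono)
      then show "emeasure \<nu> (E j) \<le> emeasure \<nu> (E i)"
        using \<open>j \<in> I\<close> i(1) E p by (simp add: fin(1) ennpowr_ennpowr_inverse)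
    qed
    also have "\<dots> = ennreal (card I) * emeasure \<nu> (E i)"
      by (simp add: ennreal_of_nat_eq_real_of_nat)
    also have "\<dots> \<le> ennreal n * emeasure \<nu> (E i)"
      using I by (intro mult_right_mono) (auto simp: ennreal_leI)
    finally have "emeasure \<nu> (\<Union>i\<in>I. E i) pow\<^sub>e (1 / p) \<le> (ennreal n * emeasure \<nu> (E i)) pow\<^sub>e (1 / p)"
      using p by (intro ennpowr_mono) auto
    then show ?thesis
      using i(1) E U p by (simp add: fin(1) ennpowr_mult p_def)
  qed
  with i(1) show ?thesis by blast
qed

section \<open>Whitney averages against N\<close>

lemma ball_measure:
  fixes x :: "real^'n::finite"
  assumes "0 \<le> t"
  shows "emeasure lebesgue (ball x t) = ennreal (unit_ball_vol (CARD('n)) * t ^ CARD('n))"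
  using emeasure_ball[OF assms, of x] by simp

lemma whitney_region:
  fixes x :: "real^'n::finite"
  assumes "0 < t"
  shows "{t/2<..t} \<times> ball x t \<in> sets borel" "{t/2<..t} \<times> ball x t \<in> sets lebesgue"
    "{t/2<..t} \<times> ball x t \<subseteq> half_space"
proof -
  show *: "{t/2<..t} \<times> ball x t \<in> sets borel" by (simp add: borel_Times)
  then show "{t/2<..t} \<times> ball x t \<in> sets lebesgue" by simp
  show "{t/2<..t} \<times> ball x t \<subseteq> half_space" using assms by auto
qed

lemma ennreal_divide_divide:
  assumes "0 < a" "0 < b"
  shows "x / ennreal a / ennreal b = ennreal (1 / (a * b)) * x"
  using assms by (cases x) (auto simp: divide_ennreal ennreal_mult[symmetric] ennreal_top_divide ennreal_mult_top field_simps)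

lemma whitney_avg_finite:
  fixes f :: "real \<times> (real^'n::finite) \<Rightarrow> complex" and r :: ennreal and \<beta> :: real and x :: "real^'n"
  assumes f: "f \<in> borel_measurable (lebesgue_on half_space)" and r: "r \<noteq> top" and t: "0 < t"
  defines "J \<equiv> (\<integral>\<^sup>+y\<in>{t/2<..t} \<times> ball x t. ennreal (norm (scaled_fun \<beta> f y) powr enn2real r) \<partial>lebesgue)"
  shows "whitney_avg r \<beta> f t x =
    (ennreal (2 / (unit_ball_vol (CARD('n)) * t ^ (CARD('n) + 1))) * J) pow\<^sub>e (1 / enn2real r)"
proof -
  have "scaled_fun \<beta> f \<in> borel_measurable (lebesgue_on ({t/2<..t} \<times> ball x t))"
    by (rule measurable_lebesgue_on_subset[OF borel_measurable_scaled_fun[OF f] whitney_region(3)[OF t]])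
  then have "(\<lambda>y. ennreal (norm (scaled_fun \<beta> f y) powr enn2real r))
      \<in> borel_measurable (lebesgue_on ({t/2<..t} \<times> ball x t))"
    by measurable
  from nn_mean_nn_mean[OF _ _ this]
  have "nn_mean {t/2<..t} (\<lambda>s. nn_mean (ball x t) (\<lambda>z.
      ennreal (norm (s powr (-\<beta>) *\<^sub>R f (s,z)) powr enn2real r)))
    = J / emeasure lebesgue (ball x t) / emeasure lebesgue {t/2<..t}"
    by (simp add: J_def scaled_fun_def)
  also have "\<dots> = ennreal (2 / (unit_ball_vol (CARD('n)) * t ^ (CARD('n) + 1))) * J"
    using t unit_ball_vol_pos[of "real CARD('n)"]
    by (subst ball_measure) (auto simp: ennreal_divide_divide field_simps)
  finally show ?thesis using r by (simp add: whitney_avg_def)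
qed

text \<open>On (t/2, t] the weight s^(-(d+1)) lies between t^(-(d+1)) and 2^(d+1) t^(-(d+1)), and
  the product of the two mean values is normalised by the same power of t. Hence the constants do
  not depend on t. For \<open>r = top\<close> both sides agree.\<close>

lemma whitney_avg_comparable_local_norm:
  fixes r :: ennreal and \<beta> :: real
  assumes r: "0 < r"
  shows "\<exists>C>0. \<forall>f \<in> borel_measurable (lebesgue_on half_space). \<forall>t>0. \<forall>x :: real^'n::finite.
    whitney_avg r \<beta> f t x \<le> ennreal C * local_norm r \<beta> f ({t/2<..t} \<times> ball x t) \<and>
    local_norm r \<beta> f ({t/2<..t} \<times> ball x t) \<le> ennreal C * whitney_avg r \<beta> f t x"
proof (cases "r = top")
  case True
  then have "whitney_avg r \<beta> f t x = local_norm r \<beta> f ({t/2<..t} \<times> ball x t)"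
    if "f \<in> borel_measurable (lebesgue_on half_space)" "0 < t" for f t and x :: "real^'n"
    using local_norm_top[OF that(1) whitney_region(2,3)[OF that(2)]]
    by (simp add: whitney_avg_def scaled_fun_def case_prod_unfold)
  then show ?thesis by (intro exI[of _ 1]) auto
next
  case False
  define d where "d = CARD('n)"
  define \<omega> where "\<omega> = unit_ball_vol (real d)"
  have \<omega>: "0 < \<omega>" by (simp add: \<omega>_def)
  define p where "p = enn2real r"
  have p: "0 < p" using r False by (simp add: p_def enn2real_positive_iff less_top)
  \<comment> \<open>Here \<omega> is the volume of the unit ball. The average carries the factor
    2/(\<omega> t^(d+1)). Dividing it by the lower bound of the weight gives 2/\<omega>; dividing
    the upper bound of the weight by it gives 2^d \<omega>.\<close>
  define C where "C = max (2 / \<omega>) (2 ^ d * \<omega>)"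
  have C: "0 < C" "2 / \<omega> \<le> C" "2 ^ d * \<omega> \<le> C" using \<omega> by (auto simp: C_def less_max_iff_disj)
  show ?thesis
  proof (intro exI[of _ "C powr (1 / p)"] conjI ballI allI impI)
    show "0 < C powr (1 / p)" using C by simp
    fix f :: "real \<times> (real^'n) \<Rightarrow> complex" and t :: real and x :: "real^'n"
    assume f: "f \<in> borel_measurable (lebesgue_on half_space)" and t: "0 < t"
    define E where "E = {t/2<..t} \<times> ball x t"
    define J where "J = (\<integral>\<^sup>+y\<in>E. ennreal (norm (scaled_fun \<beta> f y) powr p) \<partial>lebesgue)"
    define L where "L = (\<integral>\<^sup>+y\<in>E. tent_weight y * ennreal (norm (scaled_fun \<beta> f y) powr p) \<partial>lebesgue)"
    note E = whitney_region[OF t, of x, folded E_def]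
    have Lr: "local_norm r \<beta> f E = L pow\<^sub>e (1 / p)"
      using local_norm_finite(1,3)[OF f E(2,3) False] by (simp add: L_def p_def)
    have A: "whitney_avg r \<beta> f t x = (ennreal (2 / (\<omega> * t ^ (d + 1))) * J) pow\<^sub>e (1 / p)"
      using whitney_avg_finite[OF f False t, of \<beta> x] by (simp add: J_def E_def p_def d_def \<omega>_def)
    have [measurable]: "scaled_fun \<beta> f \<in> borel_measurable (lebesgue_on E)"
      using borel_measurable_scaled_fun[OF f] E(3) by (rule measurable_lebesgue_on_subset)
    have J: "J = (\<integral>\<^sup>+y. ennreal (norm (scaled_fun \<beta> f y) powr p) \<partial>lebesgue_on E)"
      using E(2) by (simp add: J_def nn_integral_restrict_space)
    have L: "L = (\<integral>\<^sup>+y. tent_weight y * ennreal (norm (scaled_fun \<beta> f y) powr p) \<partial>lebesgue_on E)"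
      using E(2) by (simp add: L_def nn_integral_restrict_space)
    have w: "ennreal (1 / t ^ (d + 1)) \<le> tent_weight y" "tent_weight y \<le> ennreal (2 ^ (d + 1) / t ^ (d + 1))"
      if "y \<in> space (lebesgue_on E)" for y
    proof -
      from that have y: "t / 2 < fst y" "fst y \<le> t" by (auto simp: E_def)
      have "fst y ^ (d + 1) \<le> t ^ (d + 1)" "(t / 2) ^ (d + 1) \<le> fst y ^ (d + 1)"
        using y t by (intro power_mono; simp)+
      then show "ennreal (1 / t ^ (d + 1)) \<le> tent_weight y" "tent_weight y \<le> ennreal (2 ^ (d + 1) / t ^ (d + 1))"
        using y t unfolding tent_weight_def case_prod_beta d_def[symmetric]
        by (auto intro!: ennreal_leI simp: field_simps simp del: power_Suc)
    qed
    have "ennreal (1 / t ^ (d + 1)) * J \<le> L"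
      unfolding J L using w(1)
      by (subst nn_integral_cmult[symmetric]) (auto intro!: nn_integral_mono mult_right_mono)
    then have "ennreal (2 / \<omega>) * (ennreal (1 / t ^ (d + 1)) * J) \<le> ennreal C * L"
      using C \<omega> by (intro mult_mono) (auto intro: ennreal_leI)
    then have "ennreal (2 / (\<omega> * t ^ (d + 1))) * J \<le> ennreal C * L"
      using \<omega> t by (simp add: mult.assoc[symmetric] ennreal_mult''[symmetric])
    then have "whitney_avg r \<beta> f t x \<le> (ennreal C * L) pow\<^sub>e (1 / p)"
      unfolding A using p by (intro ennpowr_mono) auto
    then show "whitney_avg r \<beta> f t x \<le> ennreal (C powr (1 / p)) * local_norm r \<beta> f ({t/2<..t} \<times> ball x t)"
      using p C by (simp add: ennpowr_mult Lr flip: E_def)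
    have "L \<le> ennreal (2 ^ (d + 1) / t ^ (d + 1)) * J"
      unfolding J L using w(2)
      by (subst nn_integral_cmult[symmetric]) (auto intro!: nn_integral_mono mult_right_mono)
    also have "\<dots> = ennreal (2 ^ d * \<omega>) * (ennreal (2 / (\<omega> * t ^ (d + 1))) * J)"
      using \<omega> t by (simp add: mult.assoc[symmetric] ennreal_mult''[symmetric] mult.commute[of _ "2 ^ d"])
    also have "\<dots> \<le> ennreal C * (ennreal (2 / (\<omega> * t ^ (d + 1))) * J)"
      using C by (intro mult_right_mono) (auto intro: ennreal_leI)
    finally have "local_norm r \<beta> f E \<le> (ennreal C * (ennreal (2 / (\<omega> * t ^ (d + 1))) * J)) pow\<^sub>e (1 / p)"
      unfolding Lr using p by (intro ennpowr_mono) auto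
    then show "local_norm r \<beta> f ({t/2<..t} \<times> ball x t) \<le> ennreal (C powr (1 / p)) * whitney_avg r \<beta> f t x"
      using p C unfolding A E_def[symmetric] by (subst (asm) ennpowr_mult) auto
  qed
qed

section \<open>Coefficients of the dyadic norm against N\<close>

definition cube_coeff ::
  "ennreal \<Rightarrow> real \<Rightarrow> (real \<times> (real^'n::finite) \<Rightarrow> complex) \<Rightarrow> (real^'n) set \<Rightarrow> ennreal" where
  "cube_coeff r \<beta> f Q =
     ennreal (measure lebesgue Q powr (-\<beta> / CARD('n))) * Lr_norm r (whitney_measure Q) f"

lemma whitney_box_measurable:
  fixes Q :: "(real^'n::finite) set"
  assumes "Q \<in> dyadic_cubes_at k"
  shows "whitney_box Q = {2 powi k / 2<..2 powi k} \<times> Q"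
    "whitney_box Q \<in> sets lebesgue" "whitney_box Q \<subseteq> half_space"
proof -
  show *: "whitney_box Q = {2 powi k / 2<..2 powi k} \<times> Q"
    using assms by (simp add: whitney_box_def side_length_eq)
  have "(0::real) < 2 powi k" by simp
  then show "whitney_box Q \<subseteq> half_space" unfolding * by fastforce
  show "whitney_box Q \<in> sets lebesgue"
    unfolding * using dyadic_cube_measure(1)[OF assms] by (intro sets_completionI_sets) (simp add: borel_Times)
qed

text \<open>The factor |Q|^(-\<beta>/d) is \<ell>(Q)^(-\<beta>), and every height in the Whitney box
  is within a factor 2 of \<ell>(Q), so the two powers differ by at most 2^|\<beta>|.\<close>

lemma cube_coeff_comparable_local_norm:
  fixes f :: "real \<times> (real^'n::finite) \<Rightarrow> complex" and r :: ennreal and \<beta> :: real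
  assumes r: "0 < r" and f: "f \<in> borel_measurable (lebesgue_on half_space)"
    and Q: "Q \<in> dyadic_cubes_at k"
  shows "cube_coeff r \<beta> f Q \<le> ennreal (2 powr \<bar>\<beta>\<bar>) * local_norm r \<beta> f (whitney_box Q)"
    "local_norm r \<beta> f (whitney_box Q) \<le> ennreal (2 powr \<bar>\<beta>\<bar>) * cube_coeff r \<beta> f Q"
proof -
  define l :: real where "l = 2 powi k"
  have l: "0 < l" by (simp add: l_def)
  define M where "M = density (lebesgue_on (whitney_box Q)) tent_weight"
  have W: "whitney_measure Q = M"
    by (simp add: M_def whitney_measure_def tent_weight_def)
  have vol: "measure lebesgue Q powr (-\<beta> / CARD('n)) = l powr (-\<beta>)"
    using dyadic_cube_measure[OF Q] l
    by (simp add: measure_def l_def[symmetric] powr_powr flip: powr_realpow)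
  have fM: "f \<in> borel_measurable M"
    using measurable_lebesgue_on_subset[OF f whitney_box_measurable(3)[OF Q]] by (simp add: M_def)
  have gM: "scaled_fun \<beta> f \<in> borel_measurable M"
    using measurable_lebesgue_on_subset[OF borel_measurable_scaled_fun[OF f] whitney_box_measurable(3)[OF Q]]
    by (simp add: M_def)
  have s: "s powr (-\<beta>) \<le> 2 powr \<bar>\<beta>\<bar> * l powr (-\<beta>)" "l powr (-\<beta>) \<le> 2 powr \<bar>\<beta>\<bar> * s powr (-\<beta>)"
    if "l / 2 < s" "s \<le> l" for s
  proof -
    \<comment> \<open>Working with logarithms and absolute values covers both signs of \<beta> at
      once.\<close>
    have "\<bar>ln s - ln l\<bar> \<le> ln 2"
      using that l ln_less_cancel_iff[of "l / 2" s] ln_le_cancel_iff[of s l] by (auto simp: ln_div)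
    then have "\<bar>\<beta>\<bar> * \<bar>ln s - ln l\<bar> \<le> \<bar>\<beta>\<bar> * ln 2" by (intro mult_left_mono) auto
    then have "\<bar>\<beta> * ln s - \<beta> * ln l\<bar> \<le> \<bar>\<beta>\<bar> * ln 2" by (simp add: abs_mult[symmetric] right_diff_distrib)
    then show "s powr (-\<beta>) \<le> 2 powr \<bar>\<beta>\<bar> * l powr (-\<beta>)" "l powr (-\<beta>) \<le> 2 powr \<bar>\<beta>\<bar> * s powr (-\<beta>)"
      using that l by (auto simp: powr_def exp_add[symmetric])
  qed
  have sp: "l / 2 < fst y" "fst y \<le> l" if "y \<in> space M" for y
    using that by (auto simp: M_def whitney_box_measurable(1)[OF Q] l_def)
  have "Lr_norm r M f \<le> ennreal (2 powr \<bar>\<beta>\<bar> * l powr \<beta>) * Lr_norm r M (scaled_fun \<beta> f)"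
  proof (rule Lr_norm_scale[OF r _ fM gM])
    fix y assume "y \<in> space M"
    then have "l powr (-\<beta>) * norm (f y) \<le> (2 powr \<bar>\<beta>\<bar> * fst y powr (-\<beta>)) * norm (f y)"
      by (intro mult_right_mono s sp) auto
    then show "norm (f y) \<le> 2 powr \<bar>\<beta>\<bar> * l powr \<beta> * norm (scaled_fun \<beta> f y)"
      using l by (simp add: scaled_fun_def case_prod_beta powr_minus field_simps)
  qed (use l in simp)
  then have "ennreal (l powr (-\<beta>)) * Lr_norm r M f
      \<le> ennreal (l powr (-\<beta>)) * (ennreal (2 powr \<bar>\<beta>\<bar> * l powr \<beta>) * Lr_norm r M (scaled_fun \<beta> f))"
    by (rule mult_left_mono) simp
  also have "\<dots> = ennreal (l powr (-\<beta>) * (2 powr \<bar>\<beta>\<bar> * l powr \<beta>)) * Lr_norm r M (scaled_fun \<beta> f)"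
    by (simp add: mult.assoc[symmetric] ennreal_mult''[symmetric])
  also have "l powr (-\<beta>) * (2 powr \<bar>\<beta>\<bar> * l powr \<beta>) = 2 powr \<bar>\<beta>\<bar>"
    using l by (simp add: powr_minus)
  finally show "cube_coeff r \<beta> f Q \<le> ennreal (2 powr \<bar>\<beta>\<bar>) * local_norm r \<beta> f (whitney_box Q)"
    unfolding cube_coeff_def local_norm_def W vol M_def[symmetric] .
  have "Lr_norm r M (scaled_fun \<beta> f) \<le> ennreal (2 powr \<bar>\<beta>\<bar> * l powr (-\<beta>)) * Lr_norm r M f"
  proof (rule Lr_norm_scale[OF r _ gM fM])
    fix y assume "y \<in> space M"
    then have "fst y powr (-\<beta>) * norm (f y) \<le> (2 powr \<bar>\<beta>\<bar> * l powr (-\<beta>)) * norm (f y)"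
      by (intro mult_right_mono s sp) auto
    then show "norm (scaled_fun \<beta> f y) \<le> 2 powr \<bar>\<beta>\<bar> * l powr (-\<beta>) * norm (f y)"
      by (simp add: scaled_fun_def case_prod_beta)
  qed (use l in simp)
  then show "local_norm r \<beta> f (whitney_box Q) \<le> ennreal (2 powr \<bar>\<beta>\<bar>) * cube_coeff r \<beta> f Q"
    unfolding cube_coeff_def local_norm_def W vol M_def[symmetric]
    by (simp add: mult.assoc ennreal_mult')
qed

section \<open>Averaging regions and Whitney boxes\<close>

lemma dyadic_scale_exists:
  assumes "0 < (t::real)"
  obtains k :: int where "2 powi (k - 1) < t" "t \<le> 2 powi k"
proof -
  define k where "k = \<lceil>log 2 t\<rceil>"
  have "of_int k - 1 < log 2 t" "log 2 t \<le> of_int k" unfolding k_def by linarith+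
  then have "2 powr (of_int k - 1) < t" "t \<le> 2 powr (of_int k)"
    using assms by (simp_all add: less_log_iff log_le_iff)
  then have "2 powi (k - 1) < t" "t \<le> 2 powi k"
    using powr_real_of_int'[of 2 "k - 1"] powr_real_of_int'[of 2 k] by simp_all
  then show thesis by (rule that)
qed

lemma powi_minus_one: "(2::real) powi (k - 1) = 2 powi k / 2"
  by (simp add: power_int_diff)

text \<open>If t lies in (2^(k-1), 2^k], the heights (t/2, t] meet only the layers of Whitney boxes
  of generations k and k-1. About the dominating cube only its scale and position relative to (t, x)
  are recorded, which is what the integration over a Carleson box uses.\<close>

lemma whitney_avg_le_cube_coeff:
  fixes r :: ennreal and \<beta> :: real
  assumes r: "0 < r"
  shows "\<exists>C>0. \<forall>f \<in> borel_measurable (lebesgue_on half_space). \<forall>t>0. \<forall>x :: real^'n::finite.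
    \<exists>k. \<exists>Q\<in>dyadic_cubes_at k. whitney_avg r \<beta> f t x \<le> ennreal C * cube_coeff r \<beta> f Q \<and>
      2 powi k / 2 < t \<and> t \<le> 2 * 2 powi k \<and> Q \<inter> ball x t \<noteq> {}"
proof -
  obtain C1 where C1: "C1 > 0" "\<And>f t x. f \<in> borel_measurable (lebesgue_on half_space) \<Longrightarrow> t > 0 \<Longrightarrow>
    whitney_avg r \<beta> f t (x :: real^'n) \<le> ennreal C1 * local_norm r \<beta> f ({t/2<..t} \<times> ball x t)"
    using whitney_avg_comparable_local_norm[OF r, where ?'n='n, of \<beta>] by blast
  \<comment> \<open>Two generations. Since t \<le> 2 * 2^(k-1), the ball meets at most (2*2+1)^d
    cubes of either.\<close>
  define n :: nat where "n = 2 * 5 ^ CARD('n)"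
  define C2 where "C2 = real n powr (1 / enn2real r)"
  have C2: "0 < C2" by (simp add: C2_def n_def)
  show ?thesis
  proof (intro exI[of _ "C1 * (C2 * 2 powr \<bar>\<beta>\<bar>)"] conjI ballI allI impI)
    show "C1 * (C2 * 2 powr \<bar>\<beta>\<bar>) > 0" using C1 C2 by simp
    fix f :: "real \<times> (real^'n) \<Rightarrow> complex" and t :: real and x :: "real^'n"
    assume f: "f \<in> borel_measurable (lebesgue_on half_space)" and t: "0 < t"
    obtain k where k: "2 powi (k - 1) < t" "t \<le> 2 powi k" using dyadic_scale_exists[OF t] .
    have pk: "(2::real) powi (k - 1) = 2 powi k / 2" by (rule powi_minus_one)
    define F where "F j = {Q \<in> dyadic_cubes_at j. Q \<inter> ball x t \<noteq> {}}" for j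
    have F: "finite (F j)" "card (F j) \<le> 5 ^ CARD('n)" if "j = k \<or> j = k - 1" for j
      using card_dyadic_cubes_meeting_ball[of t 2 j x] that k pk by (auto simp: F_def)
    define I where "I = F k \<union> F (k - 1)"
    have "finite I" "card I \<le> n"
      using F[of k] F[of "k - 1"] card_Un_le[of "F k" "F (k - 1)"] by (auto simp: I_def n_def)
    moreover have sub: "{t/2<..t} \<times> ball x t \<subseteq> (\<Union>Q\<in>I. whitney_box Q)"
    proof
      fix y assume "y \<in> {t/2<..t} \<times> ball x t"
      then obtain s z where y: "y = (s, z)" "t / 2 < s" "s \<le> t" "z \<in> ball x t" by auto
      \<comment> \<open>The layer containing height s; s > t/2 > 2^(k-2) excludes anything below
        generation k-1.\<close>
      define j where "j = (if s \<le> 2 powi (k - 1) then k - 1 else k)"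
      obtain Q where Q: "Q \<in> dyadic_cubes_at j" "z \<in> Q" using ex1_dyadic_cubes_at by blast
      have "y \<in> whitney_box Q"
        using Q y k pk unfolding whitney_box_measurable(1)[OF Q(1)]
        by (auto simp: j_def powi_minus_one split: if_splits)
      moreover have "Q \<in> I" using Q y by (auto simp: I_def F_def j_def split: if_splits)
      ultimately show "y \<in> (\<Union>Q\<in>I. whitney_box Q)" by blast
    qed
    moreover have "I \<noteq> {}"
    proof -
      have "(t, x) \<in> {t/2<..t} \<times> ball x t" using t by auto
      with sub show ?thesis by blast
    qed
    moreover have box: "whitney_box Q \<in> sets lebesgue" "whitney_box Q \<subseteq> half_space" if "Q \<in> I" for Q
    proof -
      from that obtain j where "Q \<in> dyadic_cubes_at j" by (auto simp: I_def F_def)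
      then show "whitney_box Q \<in> sets lebesgue" "whitney_box Q \<subseteq> half_space"
        by (rule whitney_box_measurable)+
    qed
    ultimately obtain Q where Q: "Q \<in> I"
      and le: "local_norm r \<beta> f (\<Union>Q\<in>I. whitney_box Q) \<le> ennreal C2 * local_norm r \<beta> f (whitney_box Q)"
      using local_norm_UN[OF f r, of I n whitney_box \<beta>] unfolding C2_def by metis
    from Q obtain j where j: "j = k \<or> j = k - 1" "Q \<in> dyadic_cubes_at j" "Q \<inter> ball x t \<noteq> {}"
      by (auto simp: I_def F_def)
    have "(\<Union>Q\<in>I. whitney_box Q) \<in> sets lebesgue" "(\<Union>Q\<in>I. whitney_box Q) \<subseteq> half_space"
      using box \<open>finite I\<close> by auto
    note mono = local_norm_mono[OF f r whitney_region(2)[OF t] this sub, of \<beta>]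
    have "whitney_avg r \<beta> f t x \<le> ennreal C1 * local_norm r \<beta> f ({t/2<..t} \<times> ball x t)"
      by (rule C1(2)[OF f t])
    also have "\<dots> \<le> ennreal C1 * (ennreal C2 * local_norm r \<beta> f (whitney_box Q))"
      using mono le by (intro mult_left_mono) auto
    also have "\<dots> \<le> ennreal C1 * (ennreal C2 * (ennreal (2 powr \<bar>\<beta>\<bar>) * cube_coeff r \<beta> f Q))"
      by (intro mult_left_mono cube_coeff_comparable_local_norm(2)[OF r f j(2)]) auto
    also have "\<dots> = ennreal (C1 * (C2 * 2 powr \<bar>\<beta>\<bar>)) * cube_coeff r \<beta> f Q"
      using C1 C2 by (simp add: ennreal_mult mult.assoc)
    finally show "\<exists>k. \<exists>Q\<in>dyadic_cubes_at k. whitney_avg r \<beta> f t x \<le> ennreal (C1 * (C2 * 2 powr \<bar>\<beta>\<bar>)) * cube_coeff r \<beta> f Q \<and>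
      2 powi k / 2 < t \<and> t \<le> 2 * 2 powi k \<and> Q \<inter> ball x t \<noteq> {}"
      using j k t pk by (intro exI[of _ j] bexI[of _ Q]) auto
  qed
qed

text \<open>Subdividing a Whitney box into finitely many pieces that are small compared with \<open>\<ell>(Q)\<close>,
  the largest piece dominates, and each piece lies in the averaging region of every nearby point.\<close>

lemma cube_coeff_le_whitney_avg:
  fixes r :: ennreal and \<beta> :: real
  assumes r: "0 < r"
  shows "\<exists>C>0. \<forall>f \<in> borel_measurable (lebesgue_on half_space). \<forall>k. \<forall>Q \<in> dyadic_cubes_at k.
    \<exists>R \<in> dyadic_cubes_at (k - int (CARD('n) + 1)). \<exists>a\<in>{3/4, 1}. R \<subseteq> Q \<and>
      (\<forall>t\<in>{a * 2 powi k<..<(a + 1/4) * 2 powi k}. \<forall>x\<in>R.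
         cube_coeff r \<beta> f (Q :: (real^'n::finite) set) \<le> ennreal C * whitney_avg r \<beta> f t x)"
proof -
  obtain C1 where C1: "C1 > 0" "\<And>f t x. f \<in> borel_measurable (lebesgue_on half_space) \<Longrightarrow> t > 0 \<Longrightarrow>
    local_norm r \<beta> f ({t/2<..t} \<times> ball x t) \<le> ennreal C1 * whitney_avg r \<beta> f t (x :: real^'n)"
    using whitney_avg_comparable_local_norm[OF r, where ?'n='n, of \<beta>] by blast
  define d where "d = CARD('n)"
  \<comment> \<open>A subcube m = d+1 generations down has diameter at most d 2^(k-m) \<le> 2^d
    2^(k-m) = \<ell>(Q)/2. This is less than every t under consideration, so the ball of radius t
    about any point of the subcube contains the subcube.\<close>
  define m where "m = int (d + 1)"
  \<comment> \<open>Two slabs times a crude count of the subcubes: all of them meet a ball of radius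
    (d+1) \<ell>(Q) about a point of Q, and \<ell>(Q) is 2^(d+1) times their side length.\<close>
  define n :: nat where "n = 2 * (2 * ((d + 1) * 2 ^ (d + 1)) + 1) ^ d"
  define C2 where "C2 = real n powr (1 / enn2real r)"
  have "0 < n" by (simp add: n_def)
  then have C2: "0 < C2" by (simp add: C2_def)
  show ?thesis
  proof (intro exI[of _ "2 powr \<bar>\<beta>\<bar> * (C2 * C1)"] conjI ballI allI impI)
    show "2 powr \<bar>\<beta>\<bar> * (C2 * C1) > 0" using C1 C2 by simp
    fix f :: "real \<times> (real^'n) \<Rightarrow> complex" and k :: int and Q :: "(real^'n) set"
    assume f: "f \<in> borel_measurable (lebesgue_on half_space)" and Q: "Q \<in> dyadic_cubes_at k"
    define l :: real where "l = 2 powi k"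
    have l: "0 < l" by (simp add: l_def)
    have km: "(2::real) powi (k - m) * 2 ^ (d + 1) = l"
      by (simp add: l_def m_def power_int_diff power_int_add)
    define S where "S = {R \<in> dyadic_cubes_at (k - m). R \<subseteq> Q}"
    obtain z where z: "z \<in> Q" using dyadic_cubes_at_nonempty[OF Q] by blast
    let ?c = "(d + 1) * 2 ^ (d + 1)"
    have "S \<subseteq> {R \<in> dyadic_cubes_at (k - m). R \<inter> ball z ((d + 1) * l) \<noteq> {}}"
    proof
      fix R assume R: "R \<in> S"
      then obtain y where y: "y \<in> R" "y \<in> Q" using dyadic_cubes_at_nonempty by (fastforce simp: S_def)
      have "dist z y \<le> d * l" using dist_dyadic_cube_le[OF Q z y(2)] by (simp add: d_def l_def)
      also have "\<dots> < (d + 1) * l" using l by simp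
      finally show "R \<in> {R \<in> dyadic_cubes_at (k - m). R \<inter> ball z ((d + 1) * l) \<noteq> {}}"
        using R y by (auto simp: S_def)
    qed
    moreover have "(d + 1) * l \<le> real ?c * 2 powi (k - m)"
      unfolding km[symmetric] by (simp add: algebra_simps)
    note card_dyadic_cubes_meeting_ball[OF this, of z, folded d_def]
    ultimately have S: "finite S" "2 * card S \<le> n"
      by (auto simp: n_def intro: finite_subset order_trans[OF card_mono])
    have cover: "\<exists>R\<in>S. y \<in> R" if "y \<in> Q" for y
    proof -
      obtain R where R: "R \<in> dyadic_cubes_at (k - m)" "y \<in> R" using ex1_dyadic_cubes_at by blast
      then have "R \<subseteq> Q" using that Q by (intro dyadic_cubes_nested[of R "k - m" k Q]) (auto simp: m_def)
      with R show ?thesis by (auto simp: S_def)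
    qed
    define I where "I = {3/4, 1::real} \<times> S"
    \<comment> \<open>The first component of the index is the upper end of the slab as a multiple of
      l. A slab with upper end a l lies in (t/2, t] for all t in (a l, (a + 1/4) l), in both
      cases.\<close>
    define E where "E i = (if fst i = 1 then {3/4 * l<..l} else {l/2<..3/4 * l}) \<times> snd i"
      for i :: "real \<times> (real^'n) set"
    have I: "finite I" "I \<noteq> {}" "card I \<le> n"
      using S cover[OF z] by (auto simp: I_def card_cartesian_product)
    have E: "E i \<in> sets lebesgue" "E i \<subseteq> half_space" if "i \<in> I" for i
    proof -
      have "snd i \<in> sets borel" using that dyadic_cube_measure(1) by (auto simp: I_def S_def)
      then have "E i \<in> sets borel" by (auto simp: E_def borel_Times)
      then show "E i \<in> sets lebesgue" by simp
      show "E i \<subseteq> half_space" using l by (auto simp: E_def)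
    qed
    have "whitney_box Q \<subseteq> (\<Union>i\<in>I. E i)"
    proof
      fix y assume "y \<in> whitney_box Q"
      then obtain s w where y: "y = (s, w)" "l / 2 < s" "s \<le> l" "w \<in> Q"
        by (auto simp: whitney_box_measurable(1)[OF Q] l_def)
      obtain R where R: "R \<in> S" "w \<in> R" using cover[OF y(4)] by blast
      have "y \<in> E (if s \<le> 3/4 * l then 3/4 else 1, R)" using y R by (auto simp: E_def)
      then show "y \<in> (\<Union>i\<in>I. E i)" using R by (auto simp: I_def split: if_splits)
    qed
    moreover have "(\<Union>i\<in>I. E i) \<in> sets lebesgue"
      by (rule sets.finite_UN[OF I(1) E(1)])
    moreover have "(\<Union>i\<in>I. E i) \<subseteq> half_space"
      by (rule UN_least[OF E(2)])
    moreover obtain i where i: "i \<in> I"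
      and le: "local_norm r \<beta> f (\<Union>i\<in>I. E i) \<le> ennreal C2 * local_norm r \<beta> f (E i)"
      using local_norm_UN[OF f r I, of E \<beta>] E unfolding C2_def by metis
    ultimately have le: "local_norm r \<beta> f (whitney_box Q) \<le> ennreal C2 * local_norm r \<beta> f (E i)"
      by (intro order_trans[OF local_norm_mono[OF f r whitney_box_measurable(2)[OF Q]] le])
    define a R where "a = fst i" and "R = snd i"
    then have iaR: "i = (a, R)" "a = 3/4 \<or> a = 1" "R \<in> dyadic_cubes_at (k - m)" "R \<subseteq> Q"
      using i by (auto simp: I_def S_def)
    have "cube_coeff r \<beta> f Q \<le> ennreal (2 powr \<bar>\<beta>\<bar> * (C2 * C1)) * whitney_avg r \<beta> f t x"
      if t: "a * l < t" "t < (a + 1/4) * l" and x: "x \<in> R" for t x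
    proof -
      have "3/4 * l \<le> a * l" using l iaR(2) by (intro mult_right_mono) auto
      with t l have t0: "0 < t" and lt: "l / 2 < t" by linarith+
      have "E i \<subseteq> {t/2<..t} \<times> ball x t"
      proof
        fix y assume "y \<in> E i"
        then obtain s w where y: "y = (s, w)" "w \<in> R" and s: "(s, w) \<in> E i"
          by (auto simp: E_def iaR(1))
        have "t / 2 < s \<and> s \<le> t"
          using iaR(2)
        proof
          assume a: "a = 3/4"
          show ?thesis using s t l by (simp add: E_def iaR(1) a)
        next
          assume a: "a = 1"
          show ?thesis using s t l by (simp add: E_def iaR(1) a)
        qed
        moreover have "dist x w \<le> d * 2 powi (k - m)"
          using dist_dyadic_cube_le[OF iaR(3) x y(2)] by (simp add: d_def)
        moreover have "real d * 2 powi (k - m) \<le> 2 ^ d * 2 powi (k - m)"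
          using of_nat_mono[OF less_imp_le[OF less_exp[of d]], where ?'a=real] by (intro mult_right_mono) auto
        moreover have "2 ^ d * 2 powi (k - m) = l / 2" using km by (simp add: mult_ac)
        ultimately show "y \<in> {t/2<..t} \<times> ball x t" using y lt by auto
      qed
      then have "local_norm r \<beta> f (E i) \<le> local_norm r \<beta> f ({t/2<..t} \<times> ball x t)"
        by (intro local_norm_mono[OF f r] E i whitney_region t0)
      also have "\<dots> \<le> ennreal C1 * whitney_avg r \<beta> f t x" by (rule C1(2)[OF f t0])
      finally have "local_norm r \<beta> f (whitney_box Q) \<le> ennreal C2 * (ennreal C1 * whitney_avg r \<beta> f t x)"
        by (intro order_trans[OF le] mult_left_mono) auto
      then have "cube_coeff r \<beta> f Q \<le> ennreal (2 powr \<bar>\<beta>\<bar>) * (ennreal C2 * (ennreal C1 * whitney_avg r \<beta> f t x))"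
        by (intro order_trans[OF cube_coeff_comparable_local_norm(1)[OF r f Q]] mult_left_mono) auto
      then show ?thesis using C1 C2 by (simp add: ennreal_mult mult.assoc)
    qed
    then show "\<exists>R \<in> dyadic_cubes_at (k - int (CARD('n) + 1)). \<exists>a\<in>{3/4, 1}. R \<subseteq> Q \<and>
      (\<forall>t\<in>{a * 2 powi k<..<(a + 1/4) * 2 powi k}. \<forall>x\<in>R.
         cube_coeff r \<beta> f Q \<le> ennreal (2 powr \<bar>\<beta>\<bar> * (C2 * C1)) * whitney_avg r \<beta> f t x)"
      using iaR unfolding m_def d_def l_def by (intro bexI[of _ R] bexI[of _ a]) auto
  qed
qed

section \<open>Carleson sums\<close>

abbreviation subcubes :: "(real^'n::finite) set \<Rightarrow> (real^'n) set set" where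
  "subcubes P \<equiv> {Q \<in> dyadic_cubes. Q \<subseteq> P}"

text \<open>The mass that the weights b(Q)^p |Q| put on the discrete Carleson box over P. A bound by
  a constant times |P|, uniformly in P, is the Carleson packing condition.\<close>

definition carleson_sum :: "((real^'n::finite) set \<Rightarrow> ennreal) \<Rightarrow> real \<Rightarrow> (real^'n) set \<Rightarrow> ennreal" where
  "carleson_sum b p P = (\<integral>\<^sup>+Q. b Q pow\<^sub>e p * emeasure lebesgue Q \<partial>count_space (subcubes P))"

lemma dyadic_cubes_borel: "Q \<in> dyadic_cubes \<Longrightarrow> Q \<in> sets borel"
  using dyadic_cube_measure(1) by (auto simp: dyadic_cubes_def)

lemma countable_subcubes: "countable (subcubes P)"
  using countable_dyadic_cubes by (rule countable_subset[rotated]) auto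

text \<open>By Tonelli the sum and the integral over P commute, and the indicator of each Q
  integrates to |Q| because Q lies in P.\<close>

lemma dyadic_mean_eq_carleson_sum:
  fixes f :: "real \<times> (real^'n::finite) \<Rightarrow> complex" and \<beta> p :: real
  assumes p: "0 < p" and P: "P \<in> sets borel"
  shows "nn_mean P (\<lambda>x. \<Sum>\<^sub>\<infinity>Q\<in>subcubes P.
      indicator Q x * ennreal (measure lebesgue Q powr (-(\<beta> * p) / CARD('n)))
        * Lr_norm r (whitney_measure Q) f pow\<^sub>e p)
    = carleson_sum (cube_coeff r \<beta> f) p P / emeasure lebesgue P"
proof -
  let ?b = "cube_coeff r \<beta> f"
  have b: "ennreal (measure lebesgue Q powr (-(\<beta> * p) / CARD('n))) * Lr_norm r (whitney_measure Q) f pow\<^sub>e p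
      = ?b Q pow\<^sub>e p" for Q
    using p by (simp add: cube_coeff_def ennpowr_mult powr_powr)
  have summand: "indicator Q x * ennreal (measure lebesgue Q powr (-(\<beta> * p) / CARD('n)))
      * Lr_norm r (whitney_measure Q) f pow\<^sub>e p = ?b Q pow\<^sub>e p * indicator Q x" for Q x
    unfolding mult.assoc b by (rule mult.commute)
  have [measurable]: "P \<in> sets lebesgue" "Q \<in> subcubes P \<Longrightarrow> Q \<in> sets lebesgue" for Q
    using P by (auto simp: dyadic_cubes_borel)
  have "(\<integral>\<^sup>+x\<in>P. (\<Sum>\<^sub>\<infinity>Q\<in>subcubes P.
      indicator Q x * ennreal (measure lebesgue Q powr (-(\<beta> * p) / CARD('n)))
        * Lr_norm r (whitney_measure Q) f pow\<^sub>e p) \<partial>lebesgue)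
    = (\<integral>\<^sup>+x. (\<integral>\<^sup>+Q. ?b Q pow\<^sub>e p * indicator Q x \<partial>count_space (subcubes P)) \<partial>lebesgue)"
  proof (rule nn_integral_cong)
    fix x
    have "(\<Sum>\<^sub>\<infinity>Q\<in>subcubes P. indicator Q x * ennreal (measure lebesgue Q powr (-(\<beta> * p) / CARD('n)))
        * Lr_norm r (whitney_measure Q) f pow\<^sub>e p) * indicator P x
      = (\<integral>\<^sup>+Q. (?b Q pow\<^sub>e p * indicator Q x) * indicator P x \<partial>count_space (subcubes P))"
      unfolding summand infsum_eq_nn_integral_count_space[OF countable_subcubes]
      by (rule nn_integral_multc[symmetric]) simp
    also have "\<dots> = (\<integral>\<^sup>+Q. ?b Q pow\<^sub>e p * indicator Q x \<partial>count_space (subcubes P))"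
      by (intro nn_integral_cong) (auto simp: indicator_def)
    finally show "(\<Sum>\<^sub>\<infinity>Q\<in>subcubes P. indicator Q x * ennreal (measure lebesgue Q powr (-(\<beta> * p) / CARD('n)))
        * Lr_norm r (whitney_measure Q) f pow\<^sub>e p) * indicator P x = \<dots>" .
  qed
  also have "\<dots> = (\<integral>\<^sup>+Q. (\<integral>\<^sup>+x. ?b Q pow\<^sub>e p * indicator Q x \<partial>lebesgue) \<partial>count_space (subcubes P))"
    using countable_subcubes by (intro nn_integral_count_space_nn_integral) auto
  also have "\<dots> = carleson_sum ?b p P"
    unfolding carleson_sum_def by (intro nn_integral_cong) (auto simp: nn_integral_cmult_indicator)
  finally show ?thesis by (simp add: nn_mean_def)
qed

text \<open>Tonelli for step functions, used in both directions of the equivalence. The iterated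
  form matches the tent norm, with the inner mean taken first and dt/t last; only the
  one-dimensional factors of each term have to be measurable.\<close>

lemma nn_integral_sum_of_rectangles:
  fixes T :: "'i \<Rightarrow> real set" and B :: "'i \<Rightarrow> 'a::euclidean_space set"
  assumes S: "countable S" and T: "\<And>i. i \<in> S \<Longrightarrow> T i \<in> sets borel" and B: "\<And>i. i \<in> S \<Longrightarrow> B i \<in> sets borel"
  shows "(\<integral>\<^sup>+t. (\<integral>\<^sup>+x. (\<integral>\<^sup>+i. c i * indicator (T i) t * indicator (B i) x \<partial>count_space S) \<partial>lebesgue)
            / V * ennreal (1 / t) \<partial>lebesgue)
    = (\<integral>\<^sup>+i. c i * emeasure lebesgue (B i) * (\<integral>\<^sup>+t. indicator (T i) t * ennreal (1 / t) \<partial>lebesgue) \<partial>count_space S) / V"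
    (is "?L = ?R")
proof -
  have [measurable]: "i \<in> S \<Longrightarrow> T i \<in> sets lebesgue" "i \<in> S \<Longrightarrow> B i \<in> sets lebesgue" for i
    using T B by auto
  have inv: "(\<lambda>t::real. ennreal (1 / t)) \<in> borel_measurable lebesgue"
    by (intro measurable_completion) measurable
  note [measurable] = inv
  have "(\<integral>\<^sup>+x. (\<integral>\<^sup>+i. c i * indicator (T i) t * indicator (B i) x \<partial>count_space S) \<partial>lebesgue)
      = (\<integral>\<^sup>+i. c i * indicator (T i) t * emeasure lebesgue (B i) \<partial>count_space S)" for t
    using S by (subst nn_integral_count_space_nn_integral)
      (auto intro!: nn_integral_cong simp: nn_integral_cmult_indicator)
  then have "?L = (\<integral>\<^sup>+t. (\<integral>\<^sup>+i. c i * indicator (T i) t * emeasure lebesgue (B i) / V * ennreal (1 / t)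
      \<partial>count_space S) \<partial>lebesgue)"
    by (simp add: nn_integral_divide nn_integral_multc)
  also have "\<dots> = (\<integral>\<^sup>+i. (\<integral>\<^sup>+t. c i * indicator (T i) t * emeasure lebesgue (B i) / V * ennreal (1 / t)
      \<partial>lebesgue) \<partial>count_space S)"
    using S by (rule nn_integral_count_space_nn_integral) measurable
  also have "\<dots> = (\<integral>\<^sup>+i. (\<integral>\<^sup>+t. (c i * emeasure lebesgue (B i) / V) * (indicator (T i) t * ennreal (1 / t))
      \<partial>lebesgue) \<partial>count_space S)"
    by (intro nn_integral_cong) (simp add: divide_ennreal_def mult_ac)
  also have "\<dots> = (\<integral>\<^sup>+i. c i * emeasure lebesgue (B i) / V * (\<integral>\<^sup>+t. indicator (T i) t * ennreal (1 / t)
      \<partial>lebesgue) \<partial>count_space S)"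
    by (intro nn_integral_cong nn_integral_cmult) measurable
  also have "\<dots> = (\<integral>\<^sup>+i. (c i * emeasure lebesgue (B i) * (\<integral>\<^sup>+t. indicator (T i) t * ennreal (1 / t)
      \<partial>lebesgue)) / V \<partial>count_space S)"
    by (intro nn_integral_cong) (simp add: divide_ennreal_def mult_ac)
  also have "\<dots> = ?R" by (rule nn_integral_divide) simp
  finally show ?thesis .
qed

lemma nn_integral_inverse_le:
  assumes "T \<in> sets borel" "\<And>t. t \<in> T \<Longrightarrow> 0 < a \<and> a \<le> t"
  shows "(\<integral>\<^sup>+t. indicator T t * ennreal (1 / t) \<partial>lebesgue) \<le> ennreal (1 / a) * emeasure lebesgue T"
proof -
  have "(\<integral>\<^sup>+t. indicator T t * ennreal (1 / t) \<partial>lebesgue) \<le> (\<integral>\<^sup>+t. ennreal (1 / a) * indicator T t \<partial>lebesgue)"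
    using assms(2) by (intro nn_integral_mono) (auto simp: indicator_def intro!: ennreal_leI frac_le)
  then show ?thesis using assms(1) by (simp add: nn_integral_cmult_indicator)
qed

lemma nn_integral_inverse_ge:
  assumes "T \<in> sets borel" "\<And>t. t \<in> T \<Longrightarrow> 0 < t \<and> t \<le> a"
  shows "ennreal (1 / a) * emeasure lebesgue T \<le> (\<integral>\<^sup>+t. indicator T t * ennreal (1 / t) \<partial>lebesgue)"
proof -
  have "(\<integral>\<^sup>+t. ennreal (1 / a) * indicator T t \<partial>lebesgue) \<le> (\<integral>\<^sup>+t. indicator T t * ennreal (1 / t) \<partial>lebesgue)"
    using assms(2) by (intro nn_integral_mono) (auto simp: indicator_def intro!: ennreal_leI frac_le)
  then show ?thesis using assms(1) by (simp add: nn_integral_cmult_indicator)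
qed

text \<open>A cube that lies in some member of F is counted at least once on the right-hand
  side.\<close>

lemma carleson_sum_UN_le:
  assumes F: "finite F"
  shows "(\<integral>\<^sup>+Q. b Q pow\<^sub>e p * emeasure lebesgue Q \<partial>count_space (\<Union>P\<in>F. subcubes P))
    \<le> (\<Sum>P\<in>F. carleson_sum b p P)"
proof -
  let ?g = "\<lambda>Q. b Q pow\<^sub>e p * emeasure lebesgue Q"
  have "(\<integral>\<^sup>+Q. ?g Q \<partial>count_space (\<Union>P\<in>F. subcubes P))
      = (\<integral>\<^sup>+Q. ?g Q * indicator (\<Union>P\<in>F. subcubes P) Q \<partial>count_space UNIV)"
    by (subst nn_integral_count_space_indicator) auto
  also have "\<dots> \<le> (\<integral>\<^sup>+Q. (\<Sum>P\<in>F. ?g Q * indicator (subcubes P) Q) \<partial>count_space UNIV)"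
  proof (rule nn_integral_mono)
    fix Q
    show "?g Q * indicator (\<Union>P\<in>F. subcubes P) Q \<le> (\<Sum>P\<in>F. ?g Q * indicator (subcubes P) Q)"
    proof (cases "\<exists>P\<in>F. Q \<in> subcubes P")
      case True
      then obtain P where P: "P \<in> F" "Q \<in> subcubes P" by blast
      then have "?g Q * indicator (\<Union>P\<in>F. subcubes P) Q = ?g Q * indicator (subcubes P) Q"
        by (auto simp: indicator_def)
      also have "\<dots> \<le> (\<Sum>P\<in>F. ?g Q * indicator (subcubes P) Q)"
        using F P(1) by (intro member_le_sum) auto
      finally show ?thesis .
    qed (auto simp: indicator_def)
  qed
  also have "\<dots> = (\<Sum>P\<in>F. carleson_sum b p P)"
    unfolding carleson_sum_def
    by (subst nn_integral_sum) (auto simp: nn_integral_count_space_indicator)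
  finally show ?thesis .
qed

section \<open>From packing of cubes to tents\<close>

text \<open>Pitfall: for a non-measurable \<open>A\<close> these are lower integrals, which are monotone but not linear,
  so all sums and constants are kept on the side of the step functions.\<close>

lemma tent_integral_le_carleson_sum:
  fixes A :: "real \<Rightarrow> real^'n::finite \<Rightarrow> ennreal"
  assumes C: "0 < C" and p: "0 < p" and \<tau>: "0 < \<tau>"
    and A: "\<And>t x. 0 < t \<Longrightarrow> \<exists>k. \<exists>Q\<in>dyadic_cubes_at k. A t x \<le> ennreal C * b Q \<and>
      2 powi k / 2 < t \<and> t \<le> 2 * 2 powi k \<and> Q \<inter> ball x t \<noteq> {}"
    and D: "\<And>P. P \<in> dyadic_cubes \<Longrightarrow> carleson_sum b p P \<le> D * emeasure lebesgue P"
  shows "(\<integral>\<^sup>+t\<in>{0<..<\<tau>}. nn_mean (ball y \<tau>) (\<lambda>x. A t x pow\<^sub>e p) * ennreal (1 / t) \<partial>lebesgue)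
    \<le> ennreal (3 * C powr p * (12 * (CARD('n) + 2)) ^ CARD('n)) * D"
proof -
  define d where "d = CARD('n)"
  define \<omega> where "\<omega> = unit_ball_vol (real d)"
  have \<omega>: "0 < \<omega>" by (simp add: \<omega>_def)
  \<comment> \<open>For t < \<tau> and x in the ball about y, the ball of radius t about x stays
    within distance 2\<tau> of y, and the cube attached to (t, x) has side length below 2t < 2\<tau>
    \<le> 2^K. So it is contained in a cube of generation K that meets the ball of radius
    2\<tau>.\<close>
  obtain K where K: "2 powi (K - 1) < 2 * \<tau>" "2 * \<tau> \<le> 2 powi K"
    using dyadic_scale_exists[of "2 * \<tau>"] \<tau> by auto
  define F where "F = {P \<in> dyadic_cubes_at K. P \<inter> ball y (2 * \<tau>) \<noteq> {}}"
  have F: "finite F" "card F \<le> 3 ^ d"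
    using card_dyadic_cubes_meeting_ball[of "2 * \<tau>" 1 K y] K by (auto simp: F_def d_def)
  define S where "S = (\<Union>P\<in>F. subcubes P)"
  have S: "countable S" unfolding S_def using F(1) by (intro countable_UN countable_finite countable_subcubes)
  define z where "z Q = (SOME x. x \<in> Q)" for Q :: "(real^'n) set"
  define l where "l Q = side_length Q" for Q :: "(real^'n) set"
  define T where "T Q = {l Q / 2<..2 * l Q}" for Q :: "(real^'n) set"
  \<comment> \<open>A point x whose attached cube is Q is within t \<le> 2 \<ell>(Q) of some point
    of Q, and that point is within d \<ell>(Q) of \<open>z Q\<close>.\<close>
  define B where "B Q = ball (z Q) ((d + 2) * l Q)" for Q :: "(real^'n) set"
  have Q: "z Q \<in> Q" "0 < l Q" "emeasure lebesgue Q = ennreal (l Q ^ d)" "Q \<in> dyadic_cubes_at k \<Longrightarrow> l Q = 2 powi k"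
    if "Q \<in> dyadic_cubes" for Q k
  proof -
    from that obtain j where j: "Q \<in> dyadic_cubes_at j" by (auto simp: dyadic_cubes_def)
    show "z Q \<in> Q" unfolding z_def using dyadic_cubes_at_nonempty[OF j] by (rule someI_ex)
    show "0 < l Q" "emeasure lebesgue Q = ennreal (l Q ^ d)"
      using j dyadic_cube_measure(2)[OF j] by (simp_all add: l_def d_def side_length_eq)
    show "Q \<in> dyadic_cubes_at k \<Longrightarrow> l Q = 2 powi k" by (simp add: l_def side_length_eq)
  qed
  have S': "S \<subseteq> dyadic_cubes" by (auto simp: S_def)
  define c where "c Q = ennreal (C powr p) * b Q pow\<^sub>e p" for Q
  \<comment> \<open>The cube provided for (t, x) contributes one term of the sum, and the other
    terms are nonnegative. Thus a majorant independent of the choice of cube is obtained.\<close>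
  have pointwise: "A t x pow\<^sub>e p \<le> (\<integral>\<^sup>+Q. c Q * indicator (T Q) t * indicator (B Q) x \<partial>count_space S)"
    if t: "0 < t" "t < \<tau>" and x: "x \<in> ball y \<tau>" for t x
  proof -
    obtain k Q0 where k: "Q0 \<in> dyadic_cubes_at k" "A t x \<le> ennreal C * b Q0"
      "2 powi k / 2 < t" "t \<le> 2 * 2 powi k" "Q0 \<inter> ball x t \<noteq> {}"
      using A[OF t(1)] by blast
    then obtain w where w: "w \<in> Q0" "dist x w < t" by auto
    have Q0: "Q0 \<in> dyadic_cubes" "l Q0 = 2 powi k"
      using k(1) by (auto simp: dyadic_cubes_def l_def side_length_eq)
    have "dist y w < 2 * \<tau>" using dist_triangle[of y w x] w x t by simp
    moreover obtain P where P: "P \<in> dyadic_cubes_at K" "w \<in> P" using ex1_dyadic_cubes_at by blast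
    ultimately have "P \<in> F" by (auto simp: F_def)
    moreover have "k \<le> K"
    proof (rule ccontr)
      assume "\<not> k \<le> K"
      then have "(2::real) powi K \<le> 2 powi k" by (intro power_int_increasing) auto
      with K k t show False by linarith
    qed
    then have "Q0 \<subseteq> P" using k(1) P w by (intro dyadic_cubes_nested[of Q0 k K P]) auto
    ultimately have "Q0 \<in> S" using Q0 by (auto simp: S_def)
    have "dist (z Q0) x < (d + 2) * l Q0"
      using dist_triangle2[of "z Q0" x w] dist_dyadic_cube_le[OF k(1) Q(1)[OF Q0(1)] w(1)] w k Q0
      by (simp add: d_def algebra_simps)
    then have "x \<in> B Q0" by (simp add: B_def)
    moreover have "t \<in> T Q0" using k Q0 by (simp add: T_def)
    moreover have "A t x pow\<^sub>e p \<le> c Q0"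
      using ennpowr_mono[OF k(2) p] C p by (simp add: ennpowr_mult c_def)
    ultimately have "A t x pow\<^sub>e p \<le> c Q0 * indicator (T Q0) t * indicator (B Q0) x" by simp
    also have "\<dots> \<le> (\<integral>\<^sup>+Q. c Q * indicator (T Q) t * indicator (B Q) x \<partial>count_space S)"
      using \<open>Q0 \<in> S\<close> by (rule nn_integral_ge_point)
    finally show ?thesis .
  qed
  let ?V = "emeasure lebesgue (ball y \<tau>)"
  have V: "?V = ennreal (\<omega> * \<tau> ^ d)" using \<tau> ball_measure[of \<tau> y] by (simp add: \<omega>_def d_def)
  have "(\<integral>\<^sup>+t\<in>{0<..<\<tau>}. nn_mean (ball y \<tau>) (\<lambda>x. A t x pow\<^sub>e p) * ennreal (1 / t) \<partial>lebesgue)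
    \<le> (\<integral>\<^sup>+t. (\<integral>\<^sup>+x. (\<integral>\<^sup>+Q. c Q * indicator (T Q) t * indicator (B Q) x \<partial>count_space S) \<partial>lebesgue)
            / ?V * ennreal (1 / t) \<partial>lebesgue)"
  proof (rule nn_integral_mono)
    fix t :: real
    show "nn_mean (ball y \<tau>) (\<lambda>x. A t x pow\<^sub>e p) * ennreal (1 / t) * indicator {0<..<\<tau>} t
      \<le> (\<integral>\<^sup>+x. (\<integral>\<^sup>+Q. c Q * indicator (T Q) t * indicator (B Q) x \<partial>count_space S) \<partial>lebesgue)
            / ?V * ennreal (1 / t)"
    proof (cases "t \<in> {0<..<\<tau>}")
      case True
      then have "(\<integral>\<^sup>+x\<in>ball y \<tau>. A t x pow\<^sub>e p \<partial>lebesgue)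
        \<le> (\<integral>\<^sup>+x. (\<integral>\<^sup>+Q. c Q * indicator (T Q) t * indicator (B Q) x \<partial>count_space S) \<partial>lebesgue)"
        using pointwise by (intro nn_integral_mono) (simp add: indicator_def)
      then show ?thesis using True
        by (auto simp: nn_mean_def intro!: mult_right_mono divide_right_mono_ennreal)
    qed simp
  qed
  also have "\<dots> = (\<integral>\<^sup>+Q. c Q * emeasure lebesgue (B Q)
      * (\<integral>\<^sup>+t. indicator (T Q) t * ennreal (1 / t) \<partial>lebesgue) \<partial>count_space S) / ?V"
    using S by (rule nn_integral_sum_of_rectangles) (auto simp: T_def B_def)
  also have "\<dots> \<le> (\<integral>\<^sup>+Q. ennreal (3 * C powr p * \<omega> * (d + 2) ^ d) * (b Q pow\<^sub>e p * emeasure lebesgue Q)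
      \<partial>count_space S) / ?V"
  proof (intro divide_right_mono_ennreal nn_integral_mono)
    fix Q0 assume "Q0 \<in> space (count_space S)"
    then have Q0: "Q0 \<in> dyadic_cubes" using S' by auto
    have B: "emeasure lebesgue (B Q0) = ennreal (\<omega> * (d + 2) ^ d) * emeasure lebesgue Q0"
      using Q(2,3)[OF Q0] ball_measure[of "(d + 2) * l Q0" "z Q0"] \<omega>
      by (simp add: B_def \<omega>_def d_def power_mult_distrib ennreal_mult[symmetric] mult_ac)
    \<comment> \<open>The interval has length 3\<ell>/2 and 1/t is at most 2/\<ell> on it, hence the
      factor 3.\<close>
    have "(\<integral>\<^sup>+t. indicator (T Q0) t * ennreal (1 / t) \<partial>lebesgue)
        \<le> ennreal (1 / (l Q0 / 2)) * emeasure lebesgue (T Q0)"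
      using Q(2)[OF Q0] by (intro nn_integral_inverse_le) (auto simp: T_def)
    also have "\<dots> = ennreal 3"
      using Q(2)[OF Q0] by (simp add: T_def ennreal_mult[symmetric])
    finally have "c Q0 * emeasure lebesgue (B Q0) * (\<integral>\<^sup>+t. indicator (T Q0) t * ennreal (1 / t) \<partial>lebesgue)
        \<le> c Q0 * emeasure lebesgue (B Q0) * ennreal 3"
      by (intro mult_left_mono) auto
    also have "\<dots> = ennreal (C powr p) * ennreal (\<omega> * (d + 2) ^ d) * ennreal 3 * (b Q0 pow\<^sub>e p * emeasure lebesgue Q0)"
      unfolding c_def B by (simp only: mult_ac)
    also have "ennreal (C powr p) * ennreal (\<omega> * (d + 2) ^ d) * ennreal 3 = ennreal (3 * C powr p * \<omega> * (d + 2) ^ d)"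
      using \<omega> by (simp add: ennreal_mult[symmetric] mult_ac del: ennreal_numeral)
    finally show "c Q0 * emeasure lebesgue (B Q0) * (\<integral>\<^sup>+t. indicator (T Q0) t * ennreal (1 / t) \<partial>lebesgue)
        \<le> ennreal (3 * C powr p * \<omega> * (d + 2) ^ d) * (b Q0 pow\<^sub>e p * emeasure lebesgue Q0)" .
  qed
  also have "\<dots> = ennreal (3 * C powr p * \<omega> * (d + 2) ^ d)
      * (\<integral>\<^sup>+Q. b Q pow\<^sub>e p * emeasure lebesgue Q \<partial>count_space S) / ?V"
    by (subst nn_integral_cmult) auto
  \<comment> \<open>There are at most 3^d cubes in F, and their side length 2^K is below 4\<tau> by
    the choice of K.\<close>
  also have "\<dots> \<le> ennreal (3 * C powr p * \<omega> * (d + 2) ^ d) * (D * ennreal (3 ^ d * (4 * \<tau>) ^ d)) / ?V"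
  proof (intro divide_right_mono_ennreal mult_left_mono)
    have "(\<integral>\<^sup>+Q. b Q pow\<^sub>e p * emeasure lebesgue Q \<partial>count_space S) \<le> (\<Sum>P\<in>F. carleson_sum b p P)"
      unfolding S_def by (rule carleson_sum_UN_le[OF F(1)])
    also have "\<dots> \<le> (\<Sum>P\<in>F. D * ennreal ((4 * \<tau>) ^ d))"
    proof (rule sum_mono)
      fix P assume P: "P \<in> F"
      then have "carleson_sum b p P \<le> D * emeasure lebesgue P"
        by (intro D) (auto simp: F_def dyadic_cubes_def)
      also have "\<dots> \<le> D * ennreal ((4 * \<tau>) ^ d)"
      proof -
        have "((2::real) powi K) ^ d \<le> (4 * \<tau>) ^ d"
          using K by (intro power_mono) (auto simp: powi_minus_one)
        then show ?thesis using P dyadic_cube_measure(2)[of P K]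
          by (intro mult_left_mono) (auto simp: F_def d_def intro: ennreal_leI)
      qed
      finally show "carleson_sum b p P \<le> D * ennreal ((4 * \<tau>) ^ d)" .
    qed
    also have "\<dots> = D * (ennreal (card F) * ennreal ((4 * \<tau>) ^ d))"
      by (simp add: ennreal_of_nat_eq_real_of_nat mult_ac)
    also have "\<dots> \<le> D * (ennreal (3 ^ d) * ennreal ((4 * \<tau>) ^ d))"
      using of_nat_mono[OF F(2), where ?'a=real] by (intro mult_left_mono mult_right_mono ennreal_leI) auto
    finally show "(\<integral>\<^sup>+Q. b Q pow\<^sub>e p * emeasure lebesgue Q \<partial>count_space S) \<le> D * ennreal (3 ^ d * (4 * \<tau>) ^ d)"
      by (simp add: ennreal_mult')
  qed auto
  also have "\<dots> = (ennreal (3 * C powr p * \<omega> * (d + 2) ^ d) * ennreal (3 ^ d * (4 * \<tau>) ^ d) / ?V) * D"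
    by (simp only: divide_ennreal_def mult_ac)
  also have "ennreal (3 * C powr p * \<omega> * (d + 2) ^ d) * ennreal (3 ^ d * (4 * \<tau>) ^ d) / ?V
      = ennreal ((3 * C powr p * \<omega> * (d + 2) ^ d) * (3 ^ d * (4 * \<tau>) ^ d) / (\<omega> * \<tau> ^ d))"
  proof -
    have "ennreal (3 * C powr p * \<omega> * (d + 2) ^ d) * ennreal (3 ^ d * (4 * \<tau>) ^ d)
        = ennreal ((3 * C powr p * \<omega> * (d + 2) ^ d) * (3 ^ d * (4 * \<tau>) ^ d))"
      by (rule ennreal_mult[symmetric]) (use \<omega> \<tau> in auto)
    then show ?thesis
      unfolding V by (simp only:) (rule divide_ennreal, use \<omega> \<tau> in auto)
  qed
  \<comment> \<open>The volume of the ball of radius \<tau> cancels \<omega> and \<tau>^d; the 12 is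
    the 3 of the cube count times the 4 of the side length.\<close>
  also have "(3 * C powr p * \<omega> * (d + 2) ^ d) * (3 ^ d * (4 * \<tau>) ^ d) / (\<omega> * \<tau> ^ d)
      = 3 * C powr p * (12 * (d + 2)) ^ d"
  proof -
    have "24 + real d * 12 = 3 * (4 * (real d + 2))" by simp
    then have "(24 + real d * 12) ^ d = 3 ^ d * (4 ^ d * (real d + 2) ^ d)"
      by (simp only: power_mult_distrib)
    then show ?thesis using \<omega> \<tau> by (simp add: field_simps)
  qed
  finally show ?thesis unfolding d_def by simp
qed

section \<open>From tents to packing of cubes\<close>

text \<open>Otherwise nesting gives the reverse inclusion, so the two cubes coincide although a cube
  has only one generation.\<close>

lemma dyadic_cubes_subset_scale:
  fixes Q :: "(real^'n::finite) set"
  assumes Q: "Q \<in> dyadic_cubes_at j" and P: "P \<in> dyadic_cubes_at k" and "Q \<subseteq> P"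
  shows "j \<le> k"
proof (rule ccontr)
  assume "\<not> j \<le> k"
  moreover have "P \<inter> Q \<noteq> {}" using dyadic_cubes_at_nonempty[OF Q] \<open>Q \<subseteq> P\<close> by auto
  ultimately have "P \<subseteq> Q" using Q P by (intro dyadic_cubes_nested[of P k j Q]) auto
  then show False using Q P \<open>Q \<subseteq> P\<close> \<open>\<not> j \<le> k\<close> dyadic_cubes_at_unique[of P k j] by auto
qed

text \<open>Each cube gets a rectangle \<open>T Q \<times> R Q\<close> on which A dominates its
  coefficient. These rectangles are pairwise disjoint, so the sum of the step functions is at most
  A^p at every point, and their mass for dx dt/t is at least a fixed fraction of |Q|.\<close>

lemma carleson_sum_le_tent_integral:
  fixes A :: "real \<Rightarrow> real^'n::finite \<Rightarrow> ennreal" and m :: nat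
  assumes c: "0 < c" and p: "0 < p"
    and A: "\<And>k Q. Q \<in> dyadic_cubes_at k \<Longrightarrow> \<exists>R \<in> dyadic_cubes_at (k - int m). \<exists>a\<in>{3/4, 1}. R \<subseteq> Q \<and>
      (\<forall>t\<in>{a * 2 powi k<..<(a + 1/4) * 2 powi k}. \<forall>x\<in>R. ennreal c * b Q \<le> A t x)"
    and E: "\<And>\<tau> y. 0 < \<tau> \<Longrightarrow>
      (\<integral>\<^sup>+t\<in>{0<..<\<tau>}. nn_mean (ball y \<tau>) (\<lambda>x. A t x pow\<^sub>e p) * ennreal (1 / t) \<partial>lebesgue) \<le> E"
    and P: "P \<in> dyadic_cubes"
  shows "carleson_sum b p P / emeasure lebesgue P
    \<le> ennreal (5 * 2 ^ (m * CARD('n)) * unit_ball_vol (CARD('n)) * (CARD('n) + 2) ^ CARD('n) / c powr p) * E"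
proof -
  define d where "d = CARD('n)"
  define \<omega> where "\<omega> = unit_ball_vol (real d)"
  have \<omega>: "0 < \<omega>" by (simp add: \<omega>_def)
  obtain K where K: "P \<in> dyadic_cubes_at K" using P by (auto simp: dyadic_cubes_def)
  obtain y where y: "y \<in> P" using dyadic_cubes_at_nonempty[OF K] by blast
  define L :: real where "L = 2 powi K"
  have L: "0 < L" by (simp add: L_def)
  \<comment> \<open>The excess over d L puts P into the open ball of radius \<tau> about its point
    y. Also \<tau> \<ge> 2L exceeds all heights in play, which are below 5L/4.\<close>
  define \<tau> where "\<tau> = (d + 2) * L"
  have \<tau>: "0 < \<tau>" "2 * L \<le> \<tau>" "d * L < \<tau>" using L by (auto simp: \<tau>_def distrib_right add_pos_nonneg)
  define l where "l Q = side_length Q" for Q :: "(real^'n) set"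
  have "\<exists>R a. 3/4 \<le> a \<and> a \<le> 1 \<and> R \<subseteq> Q \<and> R \<in> sets borel \<and>
      emeasure lebesgue Q = ennreal (2 ^ (m * d)) * emeasure lebesgue R \<and>
      (\<forall>t\<in>{a * l Q<..<(a + 1/4) * l Q}. \<forall>x\<in>R. ennreal c * b Q \<le> A t x)"
    if Q: "Q \<in> dyadic_cubes" for Q
  proof -
    from Q obtain k where k: "Q \<in> dyadic_cubes_at k" by (auto simp: dyadic_cubes_def)
    obtain R a where R: "R \<in> dyadic_cubes_at (k - int m)" "a = 3/4 \<or> a = 1" "R \<subseteq> Q"
      "\<forall>t\<in>{a * 2 powi k<..<(a + 1/4) * 2 powi k}. \<forall>x\<in>R. ennreal c * b Q \<le> A t x"
      using A[OF k] by blast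
    have "(2::real) powi k = 2 ^ m * 2 powi (k - int m)" by (simp add: power_int_diff)
    then have "((2::real) powi k) ^ d = 2 ^ (m * d) * (2 powi (k - int m)) ^ d"
      by (simp add: power_mult_distrib power_mult)
    then have "emeasure lebesgue Q = ennreal (2 ^ (m * d)) * emeasure lebesgue R"
      using dyadic_cube_measure(2)[OF k] dyadic_cube_measure(2)[OF R(1)]
      by (simp add: d_def ennreal_mult)
    moreover have "l Q = 2 powi k" using k by (simp add: l_def side_length_eq)
    ultimately show ?thesis using R dyadic_cube_measure(1)[OF R(1)] by (intro exI[of _ R] exI[of _ a]) auto
  qed
  then obtain R a where Ra: "\<And>Q. Q \<in> dyadic_cubes \<Longrightarrow> 3/4 \<le> a Q \<and> a Q \<le> 1 \<and> R Q \<subseteq> Q \<and> R Q \<in> sets borel \<and>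
      emeasure lebesgue Q = ennreal (2 ^ (m * d)) * emeasure lebesgue (R Q) \<and>
      (\<forall>t\<in>{a Q * l Q<..<(a Q + 1/4) * l Q}. \<forall>x\<in>R Q. ennreal c * b Q \<le> A t x)"
    by metis
  define T where "T Q = {a Q * l Q<..<(a Q + 1/4) * l Q}" for Q
  have lpos: "0 < l Q" if "Q \<in> dyadic_cubes" for Q
    using that by (auto simp: dyadic_cubes_def l_def side_length_eq)
  have T_bounds: "3/4 * l Q < t" "t < 5/4 * l Q" if "Q \<in> dyadic_cubes" "t \<in> T Q" for Q t
  proof -
    have "3/4 * l Q \<le> a Q * l Q" "(a Q + 1/4) * l Q \<le> 5/4 * l Q"
      using Ra[OF that(1)] lpos[OF that(1)] by (intro mult_right_mono; simp)+
    then show "3/4 * l Q < t" "t < 5/4 * l Q" using that(2) by (auto simp: T_def)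
  qed
  \<comment> \<open>Cubes of one generation are disjoint. Different generations are separated in
    height: all intervals lie in (3\<ell>/4, 5\<ell>/4), and 5\<ell>/4 is below 3/4 of the next side
    length 2\<ell>.\<close>
  have uniq: "Q = Q'" if Q: "Q \<in> dyadic_cubes" "t \<in> T Q" "x \<in> R Q"
    and Q': "Q' \<in> dyadic_cubes" "t \<in> T Q'" "x \<in> R Q'" for Q Q' t x
  proof -
    have le: "k' \<le> k" if Q: "Q \<in> dyadic_cubes_at k" "t \<in> T Q" and Q': "Q' \<in> dyadic_cubes_at k'" "t \<in> T Q'"
      for k k' Q Q'
    proof (rule ccontr)
      assume "\<not> k' \<le> k"
      then have "(2::real) powi (k + 1) \<le> 2 powi k'" by (intro power_int_increasing) auto
      then have "2 * l Q \<le> l Q'" using Q Q' by (simp add: l_def side_length_eq power_int_add)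
      moreover have "Q \<in> dyadic_cubes" "Q' \<in> dyadic_cubes" using Q Q' by (auto simp: dyadic_cubes_def)
      ultimately show False using T_bounds(2)[of Q t] T_bounds(1)[of Q' t] Q Q' lpos[of Q] by linarith
    qed
    obtain k k' where k: "Q \<in> dyadic_cubes_at k" "Q' \<in> dyadic_cubes_at k'"
      using Q Q' by (auto simp: dyadic_cubes_def)
    with le Q Q' have "k = k'" by (meson antisym)
    moreover have "x \<in> Q" "x \<in> Q'" using Ra Q Q' by blast+
    ultimately show ?thesis using k ex1_dyadic_cubes_at[of k x] by blast
  qed
  define g where "g Q = (ennreal c * b Q) pow\<^sub>e p" for Q
  have pointwise: "(\<integral>\<^sup>+Q. g Q * indicator (T Q) t * indicator (R Q) x \<partial>count_space (subcubes P))
    \<le> A t x pow\<^sub>e p * indicator (ball y \<tau>) x * indicator {0<..<\<tau>} t" for t x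
  proof (cases "\<exists>Q\<in>subcubes P. t \<in> T Q \<and> x \<in> R Q")
    case True
    then obtain Q where Q: "Q \<in> subcubes P" "t \<in> T Q" "x \<in> R Q" by blast
    then have Qd: "Q \<in> dyadic_cubes" "Q \<subseteq> P" by auto
    have "(\<integral>\<^sup>+Q. g Q * indicator (T Q) t * indicator (R Q) x \<partial>count_space (subcubes P))
      = (\<integral>\<^sup>+Q'. g Q * indicator {Q} Q' \<partial>count_space (subcubes P))"
      using Q uniq[of Q t x] by (intro nn_integral_cong) (auto simp: indicator_def)
    also have "\<dots> = g Q" using Q(1) by (subst nn_integral_cmult_indicator) auto
    also have "\<dots> \<le> A t x pow\<^sub>e p"
      using Ra[OF Qd(1)] Q p by (auto simp: g_def T_def intro!: ennpowr_mono)
    finally have "(\<integral>\<^sup>+Q. g Q * indicator (T Q) t * indicator (R Q) x \<partial>count_space (subcubes P)) \<le> A t x pow\<^sub>e p" .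
    moreover have "x \<in> ball y \<tau>"
    proof -
      have "x \<in> P" using Ra[OF Qd(1)] Q Qd by blast
      then show ?thesis using dist_dyadic_cube_le[OF K y] \<tau> by (force simp: d_def L_def)
    qed
    moreover have "t \<in> {0<..<\<tau>}"
    proof -
      obtain k where k: "Q \<in> dyadic_cubes_at k" using Qd by (auto simp: dyadic_cubes_def)
      have "l Q \<le> L"
        using dyadic_cubes_subset_scale[OF k K Qd(2)] k
        by (auto simp: l_def L_def side_length_eq intro!: power_int_increasing)
      then show ?thesis using T_bounds[OF Qd(1) Q(2)] lpos[OF Qd(1)] L \<tau> by auto
    qed
    ultimately show ?thesis by simp
  next
    case False
    then have "(\<integral>\<^sup>+Q. g Q * indicator (T Q) t * indicator (R Q) x \<partial>count_space (subcubes P))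
      = (\<integral>\<^sup>+Q. 0 \<partial>count_space (subcubes P))"
      by (intro nn_integral_cong) (auto simp: indicator_def)
    then show ?thesis by simp
  qed
  let ?V = "emeasure lebesgue (ball y \<tau>)"
  have V: "?V = ennreal (\<omega> * (d + 2) ^ d) * emeasure lebesgue P"
    using \<tau> \<omega> L ball_measure[of \<tau> y] dyadic_cube_measure(2)[OF K]
    by (simp add: \<omega>_def d_def \<tau>_def L_def power_mult_distrib ennreal_mult[symmetric] mult_ac)
  define v where "v = \<omega> * (d + 2) ^ d"
  have v: "0 < v" using \<omega> by (simp add: v_def)
  have "(\<integral>\<^sup>+Q. ennreal (c powr p / (5 * 2 ^ (m * d))) * (b Q pow\<^sub>e p * emeasure lebesgue Q) \<partial>count_space (subcubes P)) / ?V
    \<le> (\<integral>\<^sup>+Q. g Q * emeasure lebesgue (R Q) * (\<integral>\<^sup>+t. indicator (T Q) t * ennreal (1 / t) \<partial>lebesgue)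
          \<partial>count_space (subcubes P)) / ?V"
  proof (intro divide_right_mono_ennreal nn_integral_mono)
    fix Q assume "Q \<in> space (count_space (subcubes P))"
    then have Q: "Q \<in> dyadic_cubes" by auto
    note l = lpos[OF Q]
    \<comment> \<open>The interval has length \<ell>/4, and 1/t is at least 4/(5\<ell>) on
      it.\<close>
    have "ennreal (1 / 5) = ennreal (1 / (5/4 * l Q)) * emeasure lebesgue (T Q)"
      using l by (simp add: T_def ennreal_mult[symmetric] algebra_simps)
    also have "\<dots> \<le> (\<integral>\<^sup>+t. indicator (T Q) t * ennreal (1 / t) \<partial>lebesgue)"
    proof (rule nn_integral_inverse_ge)
      show "0 < t \<and> t \<le> 5/4 * l Q" if "t \<in> T Q" for t
        using T_bounds[OF Q that] l by linarith
    qed (simp add: T_def)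
    finally have I: "ennreal (1 / 5) \<le> (\<integral>\<^sup>+t. indicator (T Q) t * ennreal (1 / t) \<partial>lebesgue)" .
    \<comment> \<open>The power of 2 is the ratio |Q|/|R|, since R lies \<open>m\<close> generations
      below Q.\<close>
    have "ennreal (c powr p / (5 * 2 ^ (m * d))) * (b Q pow\<^sub>e p * emeasure lebesgue Q)
      = (ennreal (c powr p / (5 * 2 ^ (m * d))) * ennreal (2 ^ (m * d))) * (b Q pow\<^sub>e p * emeasure lebesgue (R Q))"
      using Ra[OF Q] by (simp only: mult_ac)
    also have "ennreal (c powr p / (5 * 2 ^ (m * d))) * ennreal (2 ^ (m * d)) = ennreal (c powr p) * ennreal (1 / 5)"
      by (simp add: ennreal_mult[symmetric])
    also have "ennreal (c powr p) * ennreal (1 / 5) * (b Q pow\<^sub>e p * emeasure lebesgue (R Q))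
      = g Q * emeasure lebesgue (R Q) * ennreal (1 / 5)"
      using c p by (simp add: g_def ennpowr_mult mult_ac)
    also have "\<dots> \<le> g Q * emeasure lebesgue (R Q) * (\<integral>\<^sup>+t. indicator (T Q) t * ennreal (1 / t) \<partial>lebesgue)"
      by (rule mult_left_mono[OF I]) simp
    finally show "ennreal (c powr p / (5 * 2 ^ (m * d))) * (b Q pow\<^sub>e p * emeasure lebesgue Q)
      \<le> g Q * emeasure lebesgue (R Q) * (\<integral>\<^sup>+t. indicator (T Q) t * ennreal (1 / t) \<partial>lebesgue)" .
  qed
  also have "\<dots> = (\<integral>\<^sup>+t. (\<integral>\<^sup>+x. (\<integral>\<^sup>+Q. g Q * indicator (T Q) t * indicator (R Q) x
      \<partial>count_space (subcubes P)) \<partial>lebesgue) / ?V * ennreal (1 / t) \<partial>lebesgue)"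
    using Ra by (intro nn_integral_sum_of_rectangles[symmetric] countable_subcubes) (auto simp: T_def)
  also have "\<dots> \<le> (\<integral>\<^sup>+t\<in>{0<..<\<tau>}. nn_mean (ball y \<tau>) (\<lambda>x. A t x pow\<^sub>e p) * ennreal (1 / t) \<partial>lebesgue)"
  proof (rule nn_integral_mono)
    fix t :: real
    have "(\<integral>\<^sup>+x. (\<integral>\<^sup>+Q. g Q * indicator (T Q) t * indicator (R Q) x \<partial>count_space (subcubes P)) \<partial>lebesgue)
      \<le> (\<integral>\<^sup>+x. A t x pow\<^sub>e p * indicator (ball y \<tau>) x * indicator {0<..<\<tau>} t \<partial>lebesgue)"
      by (intro nn_integral_mono pointwise)
    also have "\<dots> = (\<integral>\<^sup>+x\<in>ball y \<tau>. A t x pow\<^sub>e p \<partial>lebesgue) * indicator {0<..<\<tau>} t"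
      by (cases "t \<in> {0<..<\<tau>}") auto
    finally have "(\<integral>\<^sup>+x. (\<integral>\<^sup>+Q. g Q * indicator (T Q) t * indicator (R Q) x \<partial>count_space (subcubes P)) \<partial>lebesgue)
        / ?V * ennreal (1 / t)
      \<le> (\<integral>\<^sup>+x\<in>ball y \<tau>. A t x pow\<^sub>e p \<partial>lebesgue) * indicator {0<..<\<tau>} t / ?V * ennreal (1 / t)"
      by (intro mult_right_mono divide_right_mono_ennreal) auto
    then show "(\<integral>\<^sup>+x. (\<integral>\<^sup>+Q. g Q * indicator (T Q) t * indicator (R Q) x \<partial>count_space (subcubes P)) \<partial>lebesgue)
        / ?V * ennreal (1 / t)
      \<le> nn_mean (ball y \<tau>) (\<lambda>x. A t x pow\<^sub>e p) * ennreal (1 / t) * indicator {0<..<\<tau>} t"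
      by (simp only: nn_mean_def divide_ennreal_def mult_ac)
  qed
  also have "\<dots> \<le> E" by (rule E[OF \<tau>(1)])
  also have "(\<integral>\<^sup>+Q. ennreal (c powr p / (5 * 2 ^ (m * d))) * (b Q pow\<^sub>e p * emeasure lebesgue Q) \<partial>count_space (subcubes P))
    = ennreal (c powr p / (5 * 2 ^ (m * d))) * carleson_sum b p P"
    unfolding carleson_sum_def by (rule nn_integral_cmult) simp
  finally have *: "ennreal (c powr p / (5 * 2 ^ (m * d))) * carleson_sum b p P / ?V \<le> E" .
  have "inverse ?V = ennreal (1 / v) * inverse (emeasure lebesgue P)"
    unfolding V v_def[symmetric] using v dyadic_cube_measure(2)[OF K] L
    by (simp add: L_def ennreal_mult[symmetric] inverse_ennreal field_simps)
  then have "ennreal (c powr p / (5 * 2 ^ (m * d))) * carleson_sum b p P / ?V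
    = ennreal (c powr p / (5 * 2 ^ (m * d))) * ennreal (1 / v) * (carleson_sum b p P / emeasure lebesgue P)"
    by (simp only: divide_ennreal_def mult_ac)
  with * have "ennreal (5 * 2 ^ (m * d) * v / c powr p) * (ennreal (c powr p / (5 * 2 ^ (m * d))) * ennreal (1 / v)
      * (carleson_sum b p P / emeasure lebesgue P)) \<le> ennreal (5 * 2 ^ (m * d) * v / c powr p) * E"
    by (intro mult_left_mono) auto
  also have "ennreal (5 * 2 ^ (m * d) * v / c powr p) * (ennreal (c powr p / (5 * 2 ^ (m * d))) * ennreal (1 / v)
      * (carleson_sum b p P / emeasure lebesgue P))
    = ennreal (5 * 2 ^ (m * d) * v / c powr p) * ennreal (c powr p / (5 * 2 ^ (m * d))) * ennreal (1 / v)
      * (carleson_sum b p P / emeasure lebesgue P)"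
    by (simp only: mult_ac)
  also have "ennreal (5 * 2 ^ (m * d) * v / c powr p) * ennreal (c powr p / (5 * 2 ^ (m * d))) * ennreal (1 / v) = 1"
    using v c by (simp add: ennreal_mult[symmetric])
  finally show ?thesis by (simp add: v_def \<omega>_def d_def mult.assoc)
qed

section \<open>Equivalence of the norms\<close>

theorem proposition3p14:
  fixes q r :: ennreal and \<beta> :: real
  assumes "0 < q" and "0 < r"
  shows "\<exists>C::real. C > 0 \<and>
    (\<forall>f \<in> (tent_space q r \<beta> :: (real \<times> (real^'n::finite) \<Rightarrow> complex) set).
       tent_norm q r \<beta> f \<le> ennreal C * dyadic_norm q r \<beta> f \<and>
       dyadic_norm q r \<beta> f \<le> ennreal C * tent_norm q r \<beta> f)"
proof -
  obtain C1 where C1: "C1 > 0" and up: "\<And>f t x. f \<in> borel_measurable (lebesgue_on half_space) \<Longrightarrow> 0 < t \<Longrightarrow>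
      \<exists>k. \<exists>Q\<in>dyadic_cubes_at k. whitney_avg r \<beta> f t (x :: real^'n) \<le> ennreal C1 * cube_coeff r \<beta> f Q \<and>
      2 powi k / 2 < t \<and> t \<le> 2 * 2 powi k \<and> Q \<inter> ball x t \<noteq> {}"
    using whitney_avg_le_cube_coeff[OF assms(2), where ?'n='n, of \<beta>] by blast
  obtain C2 where C2: "C2 > 0" and low: "\<And>f k Q. f \<in> borel_measurable (lebesgue_on half_space) \<Longrightarrow>
      Q \<in> dyadic_cubes_at k \<Longrightarrow>
      \<exists>R \<in> dyadic_cubes_at (k - int (CARD('n) + 1)). \<exists>a\<in>{3/4, 1}. R \<subseteq> Q \<and>
      (\<forall>t\<in>{a * 2 powi k<..<(a + 1/4) * 2 powi k}. \<forall>x\<in>R.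
         cube_coeff r \<beta> f (Q :: (real^'n) set) \<le> ennreal C2 * whitney_avg r \<beta> f t x)"
    using cube_coeff_le_whitney_avg[OF assms(2), where ?'n='n, of \<beta>] by metis
  \<comment> \<open>One constant has to serve both directions, so the two separate constants are
    merged by a maximum.\<close>
  have combine: ?thesis if "0 < K1" "0 < K2"
    and "\<And>f :: real \<times> (real^'n) \<Rightarrow> complex. f \<in> borel_measurable (lebesgue_on half_space) \<Longrightarrow>
      tent_norm q r \<beta> f \<le> ennreal K1 * dyadic_norm q r \<beta> f \<and>
      dyadic_norm q r \<beta> f \<le> ennreal K2 * tent_norm q r \<beta> f" for K1 K2
  proof (intro exI[of _ "max K1 K2"] conjI ballI)
    fix f :: "real \<times> (real^'n) \<Rightarrow> complex" assume "f \<in> tent_space q r \<beta>"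
    then have f: "f \<in> borel_measurable (lebesgue_on half_space)" by (simp add: tent_space_def)
    have "ennreal K1 * a \<le> ennreal (max K1 K2) * a" "ennreal K2 * a \<le> ennreal (max K1 K2) * a" for a
      by (intro mult_right_mono ennreal_leI; simp)+
    with that(3)[OF f] show "tent_norm q r \<beta> f \<le> ennreal (max K1 K2) * dyadic_norm q r \<beta> f"
      "dyadic_norm q r \<beta> f \<le> ennreal (max K1 K2) * tent_norm q r \<beta> f"
      by (blast intro: order_trans)+
  qed (use that in auto)
  show ?thesis
  proof (cases "q = \<infinity>")
    case True
    show ?thesis
    proof (rule combine[OF C1 C2], intro conjI)
      fix f :: "real \<times> (real^'n) \<Rightarrow> complex"
      assume f: "f \<in> borel_measurable (lebesgue_on half_space)"
      have tent: "tent_norm q r \<beta> f = (SUP t\<in>{0<..}. SUP x. whitney_avg r \<beta> f t x)"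
        and dyad: "dyadic_norm q r \<beta> f = (SUP P\<in>dyadic_cubes. SUP Q\<in>subcubes P. cube_coeff r \<beta> f Q)"
        using True by (simp_all add: tent_norm_def dyadic_norm_def cube_coeff_def)
      show "tent_norm q r \<beta> f \<le> ennreal C1 * dyadic_norm q r \<beta> f"
        unfolding tent
      proof (intro SUP_least)
        fix t :: real and x :: "real^'n" assume "t \<in> {0<..}"
        then obtain k Q where Q: "Q \<in> dyadic_cubes_at k" "whitney_avg r \<beta> f t x \<le> ennreal C1 * cube_coeff r \<beta> f Q"
          using up[OF f, of t x] by auto
        then have "cube_coeff r \<beta> f Q \<le> dyadic_norm q r \<beta> f"
          \<comment> \<open>The cube itself serves as the outer cube P.\<close>
          unfolding dyad by (intro SUP_upper2[of Q dyadic_cubes] SUP_upper) (auto simp: dyadic_cubes_def)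
        then show "whitney_avg r \<beta> f t x \<le> ennreal C1 * dyadic_norm q r \<beta> f"
          by (intro order_trans[OF Q(2)] mult_left_mono) auto
      qed
      show "dyadic_norm q r \<beta> f \<le> ennreal C2 * tent_norm q r \<beta> f"
        unfolding dyad
      proof (intro SUP_least)
        fix P Q :: "(real^'n) set" assume "Q \<in> subcubes P"
        then obtain k where k: "Q \<in> dyadic_cubes_at k" by (auto simp: dyadic_cubes_def)
        obtain R a where R: "R \<in> dyadic_cubes_at (k - int (CARD('n) + 1))" "a = 3/4 \<or> a = 1"
          "\<forall>t\<in>{a * 2 powi k<..<(a + 1/4) * 2 powi k}. \<forall>x\<in>R. cube_coeff r \<beta> f Q \<le> ennreal C2 * whitney_avg r \<beta> f t x"
          using low[OF f k] by blast
        obtain x where x: "x \<in> R" using dyadic_cubes_at_nonempty[OF R(1)] by blast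
        \<comment> \<open>The midpoint of the admissible heights. As the tent norm is a genuine
          supremum here, one point (t, x) is enough.\<close>
        define t :: real where "t = (a + 1/8) * 2 powi k"
        have "t \<in> {a * 2 powi k<..<(a + 1/4) * 2 powi k}" by (simp add: t_def)
        with R(3) x have le: "cube_coeff r \<beta> f Q \<le> ennreal C2 * whitney_avg r \<beta> f t x" by blast
        have "0 < t" using R(2) by (auto simp: t_def intro!: mult_pos_pos)
        then have "whitney_avg r \<beta> f t x \<le> tent_norm q r \<beta> f"
          unfolding tent by (intro SUP_upper2[of t "{0<..}"] SUP_upper) auto
        then show "cube_coeff r \<beta> f Q \<le> ennreal C2 * tent_norm q r \<beta> f"
          by (intro order_trans[OF le] mult_left_mono) auto
      qed
    qed
  next
    case False
    define p where "p = enn2real q"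
    have p: "0 < p" using assms(1) False by (simp add: p_def enn2real_positive_iff less_top)
    define K1 where "K1 = 3 * C1 powr p * (12 * (CARD('n) + 2)) ^ CARD('n)"
    define K2 where "K2 = 5 * 2 ^ ((CARD('n) + 1) * CARD('n)) * unit_ball_vol (CARD('n)) * (CARD('n) + 2) ^ CARD('n)
      / (1 / C2) powr p"
    have K: "0 < K1" "0 < K2"
      using C1 C2 by (auto simp: K1_def K2_def simp del: of_nat_add)
    show ?thesis
    proof (rule combine[of "K1 powr (1 / p)" "K2 powr (1 / p)"], goal_cases)
      case (3 f)
      define I where "I \<tau> y = (\<integral>\<^sup>+t\<in>{0<..<\<tau>}. nn_mean (ball y \<tau>) (\<lambda>x. whitney_avg r \<beta> f t x pow\<^sub>e p)
        * ennreal (1 / t) \<partial>lebesgue)" for \<tau> y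
      define S where "S P = carleson_sum (cube_coeff r \<beta> f) p P / emeasure lebesgue P" for P
      have tent: "tent_norm q r \<beta> f = (SUP \<tau>\<in>{0<..}. SUP y. I \<tau> y pow\<^sub>e (1 / p))"
        using False by (simp add: tent_norm_def I_def p_def)
      have "dyadic_norm q r \<beta> f = (SUP P\<in>dyadic_cubes. nn_mean P (\<lambda>x. \<Sum>\<^sub>\<infinity>Q\<in>subcubes P.
          indicator Q x * ennreal (measure lebesgue Q powr (-(\<beta> * p) / CARD('n)))
            * Lr_norm r (whitney_measure Q) f pow\<^sub>e p) pow\<^sub>e (1 / p))"
        using False by (simp add: dyadic_norm_def p_def)
      also have "\<dots> = (SUP P\<in>dyadic_cubes. S P pow\<^sub>e (1 / p))"
        by (intro SUP_cong refl) (simp only: S_def dyadic_mean_eq_carleson_sum[OF p dyadic_cubes_borel])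
      finally have dyad: "dyadic_norm q r \<beta> f = \<dots>" .
      have "I \<tau> y pow\<^sub>e (1 / p) \<le> ennreal (K1 powr (1 / p)) * dyadic_norm q r \<beta> f" if \<tau>: "0 < \<tau>" for \<tau> y
      proof -
        \<comment> \<open>The \<open>p\<close>-th power of the dyadic norm is the packing constant;
          |P| may be multiplied back because it is neither 0 nor infinite.\<close>
        have D: "carleson_sum (cube_coeff r \<beta> f) p P \<le> dyadic_norm q r \<beta> f pow\<^sub>e p * emeasure lebesgue P"
          if P: "P \<in> dyadic_cubes" for P
        proof -
          obtain k where k: "P \<in> dyadic_cubes_at k" using P by (auto simp: dyadic_cubes_def)
          have "S P pow\<^sub>e (1 / p) \<le> dyadic_norm q r \<beta> f" unfolding dyad using P by (rule SUP_upper)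
          then have "S P \<le> dyadic_norm q r \<beta> f pow\<^sub>e p"
            using ennpowr_mono[OF _ p] ennpowr_ennpowr_inverse(2)[OF p] by metis
          then have "S P * emeasure lebesgue P \<le> dyadic_norm q r \<beta> f pow\<^sub>e p * emeasure lebesgue P"
            by (rule mult_right_mono) simp
          moreover have "S P * emeasure lebesgue P = carleson_sum (cube_coeff r \<beta> f) p P"
            unfolding S_def using dyadic_cube_measure(2)[OF k]
            by (intro ennreal_divide_times[THEN trans] mult_divide_eq_ennreal) auto
          ultimately show ?thesis by simp
        qed
        have "I \<tau> y \<le> ennreal K1 * dyadic_norm q r \<beta> f pow\<^sub>e p"
          unfolding I_def K1_def by (rule tent_integral_le_carleson_sum[OF C1 p \<tau> up[OF 3] D])
        then have "I \<tau> y pow\<^sub>e (1 / p) \<le> (ennreal K1 * dyadic_norm q r \<beta> f pow\<^sub>e p) pow\<^sub>e (1 / p)"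
          using p by (intro ennpowr_mono) auto
        then show ?thesis
          using p K by (simp add: ennpowr_mult ennpowr_ennpowr_inverse)
      qed
      moreover have "S P pow\<^sub>e (1 / p) \<le> ennreal (K2 powr (1 / p)) * tent_norm q r \<beta> f"
        if P: "P \<in> dyadic_cubes" for P
      proof -
        have A: "\<exists>R \<in> dyadic_cubes_at (k - int (CARD('n) + 1)). \<exists>a\<in>{3/4, 1}. R \<subseteq> Q \<and>
          (\<forall>t\<in>{a * 2 powi k<..<(a + 1/4) * 2 powi k}. \<forall>x\<in>R.
             ennreal (1 / C2) * cube_coeff r \<beta> f Q \<le> whitney_avg r \<beta> f t x)"
          if Q: "Q \<in> dyadic_cubes_at k" for k and Q :: "(real^'n) set"
        proof -
          \<comment> \<open>The constant moves to the cube coefficient, that is, to the step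
            function, before any integral of the Whitney average is formed.\<close>
          have "ennreal (1 / C2) * u \<le> w" if "u \<le> ennreal C2 * w" for u w
            using mult_left_mono[OF that, of "ennreal (1 / C2)"] C2
            by (simp add: mult.assoc[symmetric] ennreal_mult[symmetric])
          then show ?thesis using low[OF 3 Q] by meson
        qed
        have E: "I \<tau> y \<le> tent_norm q r \<beta> f pow\<^sub>e p" if "0 < \<tau>" for \<tau> y
        proof -
          have "I \<tau> y pow\<^sub>e (1 / p) \<le> tent_norm q r \<beta> f"
            unfolding tent using that by (intro SUP_upper2[of \<tau> "{0<..}"] SUP_upper) auto
          then show ?thesis using ennpowr_mono[OF _ p] ennpowr_ennpowr_inverse(2)[OF p] by metis
        qed
        have "S P \<le> ennreal K2 * tent_norm q r \<beta> f pow\<^sub>e p"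
          unfolding S_def K2_def
          by (rule carleson_sum_le_tent_integral[OF _ p A E[unfolded I_def] P]) (use C2 in auto)
        then have "S P pow\<^sub>e (1 / p) \<le> (ennreal K2 * tent_norm q r \<beta> f pow\<^sub>e p) pow\<^sub>e (1 / p)"
          using p by (intro ennpowr_mono) auto
        then show ?thesis
          using p K by (simp add: ennpowr_mult ennpowr_ennpowr_inverse)
      qed
      ultimately show ?case
        unfolding tent dyad by (auto intro!: SUP_least)
    qed (use K in auto)
  qed
qed

end
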